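(* Let $\mathcal{H}$ be a complex Hilbert space, let $A,B\in\mathcal{B}(\mathcal{H})$, and let \[ T=\begin{pmatrix}0&A\\ B&0\end{pmatrix} \] act on $\mathcal{H}\oplus\mathcal{H}$. Then, for every real $r\geq 1$ and every $0\leq\theta\leq 1$, \[ \begin{aligned} w^{2r}(T)\leq{}& \frac14\max\Big\{\left\||B|^{4r\theta}+|A^*|^{4r(1-\theta)}\right\|,\ \left\||A|^{4r\theta}+|B^*|^{4r(1-\theta)}\right\|\Big\}\\ &+\frac12\max\Big\{w\!\left(|B|^{2r\theta}|A^*|^{2r(1-\theta)}\right),\ w\!\left(|A|^{2r\theta}|B^*|^{2r(1-\theta)}\right)\Big\}. \end{aligned} \]
   Context: $\mathcal{B}(\mathcal{H})$ is the algebra of bounded linear operators on the complex Hilbert space $\mathcal{H}$, and $\|\cdot\|$ is the operator norm. $\mathcal{H}\oplus\mathcal{H}$ is the Hilbert space direct sum, and $T(x\oplus y)=Ay\oplus Bx$. For a bounded operator $S$ on a complex Hilbert space $\mathcal{K}$, the numerical radius is $w(S)=\sup\{|\langle Sx,x\rangle| : x\in\mathcal{K},\ \|x\|=1\}$, and $w^{2r}(S)$ means $(w(S))^{2r}$. $|S|=(S^*S)^{1/2}$, so $|S^*|=(SS^* )^{1/2}$. Real nonnegative powers of positive operators are taken via the continuous functional calculus, with $P^0=I$. *)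

theory Defs
  imports "HOL-Analysis.Analysis" "HOL-Computational_Algebra.Polynomial"
begin

class complex_vector = real_vector +
  fixes scaleC :: "complex \<Rightarrow> 'a \<Rightarrow> 'a"  (infixr \<open>*\<^sub>C\<close> 75)
  assumes scaleC_add_right: "c *\<^sub>C (x + y) = c *\<^sub>C x + c *\<^sub>C y"
    and scaleC_add_left: "(c + d) *\<^sub>C x = c *\<^sub>C x + d *\<^sub>C x"
    and scaleC_scaleC: "c *\<^sub>C d *\<^sub>C x = (c * d) *\<^sub>C x"
    and scaleC_of_real: "complex_of_real r *\<^sub>C x = r *\<^sub>R x"

text \<open>The inner product is linear in the first argument and conjugate-linear in the second.\<close>

class complex_inner = complex_vector + real_normed_vector +
  fixes cinner :: "'a \<Rightarrow> 'a \<Rightarrow> complex"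
  assumes cinner_commute: "cinner x y = cnj (cinner y x)"
    and cinner_add_left: "cinner (x + y) z = cinner x z + cinner y z"
    and cinner_scaleC_left: "cinner (c *\<^sub>C x) y = c * cinner x y"
    and cinner_self: "cinner x x = complex_of_real ((norm x)\<^sup>2)"

class chilbert_space = complex_inner + banach

text \<open>
  The Hilbert space direct sum of a space with itself is the product type: the library norm
  on pairs is already \<open>sqrt ((norm x)\<^sup>2 + (norm y)\<^sup>2)\<close>.
\<close>

instantiation prod :: (complex_vector, complex_vector) complex_vector
begin

definition scaleC_prod :: "complex \<Rightarrow> 'a \<times> 'b \<Rightarrow> 'a \<times> 'b"
  where "scaleC_prod c z = (c *\<^sub>C fst z, c *\<^sub>C snd z)"

instance
  by standard
    (simp_all add: scaleC_prod_def scaleR_prod_def scaleC_add_right scaleC_add_left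
      scaleC_scaleC scaleC_of_real)

end

instantiation prod :: (complex_inner, complex_inner) complex_inner
begin

definition cinner_prod :: "'a \<times> 'b \<Rightarrow> 'a \<times> 'b \<Rightarrow> complex"
  where "cinner_prod z w = cinner (fst z) (fst w) + cinner (snd z) (snd w)"

instance
proof
  fix x y z :: "'a \<times> 'b" and c :: complex
  show "cinner x y = cnj (cinner y x)"
    unfolding cinner_prod_def complex_cnj_add by (metis cinner_commute)
  show "cinner (x + y) z = cinner x z + cinner y z"
    by (simp add: cinner_prod_def cinner_add_left)
  show "cinner (c *\<^sub>C x) y = c * cinner x y"
    by (simp add: cinner_prod_def scaleC_prod_def cinner_scaleC_left algebra_simps)
  show "cinner x x = complex_of_real ((norm x)\<^sup>2)"
    by (simp add: cinner_prod_def cinner_self norm_prod_def)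
qed

end

instance prod :: (chilbert_space, chilbert_space) chilbert_space ..

text \<open>
  The type of bounded real-linear maps carries the operator norm; the bounded operators
  on a complex Hilbert space are those of its elements that are complex-linear.
\<close>

definition clinear_op :: "('a::complex_inner \<Rightarrow>\<^sub>L 'b::complex_inner) \<Rightarrow> bool"
  where "clinear_op S \<longleftrightarrow> (\<forall>c x. blinfun_apply S (c *\<^sub>C x) = c *\<^sub>C blinfun_apply S x)"

definition cadjoint :: "('a::chilbert_space \<Rightarrow>\<^sub>L 'b::chilbert_space) \<Rightarrow> ('b \<Rightarrow>\<^sub>L 'a)"
  where "cadjoint S = (THE R. \<forall>x y. cinner (blinfun_apply S x) y = cinner x (blinfun_apply R y))"

definition op_spectrum :: "('a::chilbert_space \<Rightarrow>\<^sub>L 'a) \<Rightarrow> complex set"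
  where "op_spectrum S = {z. \<not> (\<exists>R. clinear_op R \<and>
    (\<forall>x. blinfun_apply R (z *\<^sub>C x - blinfun_apply S x) = x \<and>
         z *\<^sub>C blinfun_apply R x - blinfun_apply S (blinfun_apply R x) = x))}"

definition op_poly :: "real poly \<Rightarrow> ('a::real_normed_vector \<Rightarrow>\<^sub>L 'a) \<Rightarrow> ('a \<Rightarrow>\<^sub>L 'a)"
  where "op_poly p S = (\<Sum>i\<le>degree p. coeff p i *\<^sub>R ((\<lambda>R. S o\<^sub>L R) ^^ i) id_blinfun)"

text \<open>
  Continuous functional calculus for a self-adjoint operator \<open>S\<close> (whose spectrum is real) and
  a real function \<open>f\<close> continuous on the spectrum: \<open>f(S)\<close> is the operator-norm limit of
  \<open>p\<^sub>n(S)\<close> for every sequence of polynomials \<open>p\<^sub>n\<close> converging to \<open>f\<close> uniformly on the spectrum.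
  Such sequences exist by the Weierstrass approximation theorem, and the limit exists and does
  not depend on the choice because \<open>p \<mapsto> p(S)\<close> is isometric for the supremum norm on the spectrum.
\<close>

definition op_cfc :: "(real \<Rightarrow> real) \<Rightarrow> ('a::chilbert_space \<Rightarrow>\<^sub>L 'a) \<Rightarrow> ('a \<Rightarrow>\<^sub>L 'a)"
  where "op_cfc f S = (THE R. \<forall>p :: nat \<Rightarrow> real poly.
    uniform_limit {t. complex_of_real t \<in> op_spectrum S} (\<lambda>n. poly (p n)) f sequentially \<longrightarrow>
    (\<lambda>n. op_poly (p n) S) \<longlonglongrightarrow> R)"

text \<open>
  Powers of a positive operator. The case distinction gives exponent 0 the value \<open>I\<close>, also when
  0 is in the spectrum: in the library, \<open>0 powr 0 = 0\<close>.
\<close>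

definition op_powr :: "('a::chilbert_space \<Rightarrow>\<^sub>L 'a) \<Rightarrow> real \<Rightarrow> ('a \<Rightarrow>\<^sub>L 'a)"
  where "op_powr P a = op_cfc (\<lambda>t. if a = 0 then 1 else t powr a) P"

definition op_abs :: "('a::chilbert_space \<Rightarrow>\<^sub>L 'a) \<Rightarrow> ('a \<Rightarrow>\<^sub>L 'a)"
  where "op_abs S = op_powr (cadjoint S o\<^sub>L S) (1 / 2)"

text \<open>
  Inserting 0 only matters for the zero space, which has no unit vectors: the numerical radius
  is a supremum of nonnegative reals, so it is 0 there.
\<close>

definition numerical_radius :: "('a::complex_inner \<Rightarrow>\<^sub>L 'a) \<Rightarrow> real"
  where "numerical_radius S =
    Sup (insert 0 {cmod (cinner (blinfun_apply S x) x) | x. norm x = 1})"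

lift_definition offdiag_op ::
  "('a::real_normed_vector \<Rightarrow>\<^sub>L 'a) \<Rightarrow> ('a \<Rightarrow>\<^sub>L 'a) \<Rightarrow> (('a \<times> 'a) \<Rightarrow>\<^sub>L ('a \<times> 'a))"
  is "\<lambda>A B z. (A (snd z), B (fst z))"
  by (intro bounded_linear_Pair bounded_linear_compose[OF _ bounded_linear_snd]
      bounded_linear_compose[OF _ bounded_linear_fst])

end

theory Submission
  imports Defs "HOL-Computational_Algebra.Fundamental_Theorem_Algebra"
begin

text \<open>
  The operator \<open>T\<close> has the absolute values \<open>|T| = diag(|B|, |A|)\<close> and \<open>|T\<^sup>*| = diag(|A\<^sup>*|, |B\<^sup>*|)\<close>. For a unit
  vector \<open>z = (u, v)\<close> put \<open>P = |T|\<close> to the power \<open>2r\<theta>\<close> and \<open>Q = |T\<^sup>*|\<close> to the power \<open>2r(1-\<theta>)\<close>. Three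
  inequalities give the bound for \<open>|\<langle>Tz,z\<rangle>|\<close> to the power \<open>2r\<close>. The mixed Schwarz inequality of Kato
  (\<open>mixed_Schwarz\<close>) bounds \<open>|\<langle>Tz,z\<rangle>|\<^sup>2\<close> by the product of the forms of \<open>|T|\<close> to the power \<open>2\<theta>\<close> and of \<open>|T\<^sup>*|\<close>
  to the power \<open>2(1-\<theta>)\<close>. McCarthy's inequality (\<open>McCarthy_inequality_pair\<close>), which is Jensen's inequality
  for the spectral measure of \<open>z\<close>, moves the exponent \<open>r\<close> inside the forms and leaves
  \<open>\<langle>Pz,z\<rangle>\<langle>z,Qz\<rangle>\<close>. Finally Buzano's inequality (\<open>Buzano_pair\<close>) gives
  \<open>\<langle>Pz,z\<rangle>\<langle>z,Qz\<rangle> \<le> (\<parallel>Pz\<parallel>\<parallel>Qz\<parallel> + |\<langle>Pz,Qz\<rangle>|) / 2 \<le> \<langle>(P\<^sup>2 + Q\<^sup>2)z,z\<rangle> / 4 + |\<langle>PQz,z\<rangle>| / 2\<close>. As \<open>P\<close> and \<open>Q\<close> are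
  diagonal, the norm and the numerical radius of the operators on the right are at most the maxima over their
  entries. The proof works with the entries throughout, so that powers are only taken of operators on
  the original space.

  These inequalities need the functional calculus of a positive operator \<open>S\<close>, whose core is the
  bound \<open>\<parallel>p(S)\<parallel> \<le> sup |p|\<close> over the spectrum, for real polynomials \<open>p\<close> (\<open>op_poly_norm_attained\<close>). With
  \<open>M = \<parallel>p(S)\<parallel> > 0\<close>, the operator \<open>M\<^sup>2 - p(S)\<^sup>2\<close> has no bounded left inverse
  (\<open>norm_square_not_left_invertible\<close>). If \<open>M\<^sup>2 - p\<^sup>2\<close> had no zero in the spectrum, the operator would have
  such an inverse, composed from inverses of its real linear and quadratic factors (\<open>op_poly_left_inverse\<close>): the linear factors
  are invertible because their roots lie outside the spectrum, the quadratic ones because they are coercive (\<open>coercive_inverse\<close>). With the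
  Weierstrass theorem the bound extends the polynomial calculus to continuous functions
  (\<open>op_cfc_tendsto\<close>), and the algebraic rules pass to the limit.
\<close>


section \<open>Complex inner products\<close>

lemma cinner_add_right: "cinner x (y + z) = cinner x y + cinner x z"
  by (metis cinner_commute cinner_add_left complex_cnj_add)

lemma cinner_scaleC_right: "cinner x (c *\<^sub>C y) = cnj c * cinner x y"
  by (metis cinner_commute cinner_scaleC_left complex_cnj_mult)

lemma cinner_scaleR_left: "cinner (r *\<^sub>R x) y = complex_of_real r * cinner x y"
  by (metis cinner_scaleC_left scaleC_of_real)

lemma cinner_scaleR_right: "cinner x (r *\<^sub>R y) = complex_of_real r * cinner x y"
  by (metis cinner_scaleC_right scaleC_of_real complex_cnj_complex_of_real)

lemma Re_cinner_self [simp]: "Re (cinner x x) = (norm x)\<^sup>2"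
  by (simp add: cinner_self)

lemma Re_cinner_commute: "Re (cinner x y) = Re (cinner y x)"
  by (subst cinner_commute) simp

lemma norm_add_scaleR_square:
  fixes x y :: "'a::complex_inner"
  shows "(norm (x + t *\<^sub>R y))\<^sup>2 = (norm x)\<^sup>2 + 2 * t * Re (cinner x y) + t\<^sup>2 * (norm y)\<^sup>2"
proof -
  have "(norm (x + t *\<^sub>R y))\<^sup>2 = Re (cinner (x + t *\<^sub>R y) (x + t *\<^sub>R y))"
    by simp
  also have "\<dots> = (norm x)\<^sup>2 + t * Re (cinner x y) + t * Re (cinner y x) + t\<^sup>2 * (norm y)\<^sup>2"
    unfolding cinner_add_left cinner_add_right cinner_scaleR_left cinner_scaleR_right
    by (simp add: algebra_simps power2_eq_square cinner_self)
  finally show ?thesis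
    by (simp add: Re_cinner_commute[of y x])
qed

lemma Re_cinner_le: "\<bar>Re (cinner x y)\<bar> \<le> norm x * norm (y::'a::complex_inner)"
proof (cases "y = 0")
  case True
  have "cinner x (0::'a) = 0"
    using cinner_add_right[of x 0 0] by simp
  with True show ?thesis by simp
next
  case False
  define t where "t = - Re (cinner x y) / (norm y)\<^sup>2"
  have "0 \<le> (norm (x + t *\<^sub>R y))\<^sup>2" by simp
  also have "\<dots> = (norm x)\<^sup>2 - (Re (cinner x y))\<^sup>2 / (norm y)\<^sup>2"
    unfolding norm_add_scaleR_square t_def using False
    by (simp add: field_simps power2_eq_square)
  finally have "(Re (cinner x y))\<^sup>2 \<le> (norm x * norm y)\<^sup>2"
    using False by (simp add: field_simps power_mult_distrib)
  then show ?thesis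
    by (simp add: abs_le_square_iff[symmetric] abs_mult)
qed

lemma norm_scaleC: "norm (c *\<^sub>C (x::'a::complex_inner)) = cmod c * norm x"
proof -
  have "complex_of_real ((norm (c *\<^sub>C x))\<^sup>2) = (c * cnj c) * complex_of_real ((norm x)\<^sup>2)"
    unfolding cinner_self[symmetric] cinner_scaleC_left cinner_scaleC_right by (simp only: mult_ac)
  also have "\<dots> = complex_of_real ((cmod c * norm x)\<^sup>2)"
    unfolding complex_norm_square[symmetric] by (simp add: power_mult_distrib)
  finally have "complex_of_real ((norm (c *\<^sub>C x))\<^sup>2) = complex_of_real ((cmod c * norm x)\<^sup>2)" .
  then have "(norm (c *\<^sub>C x))\<^sup>2 = (cmod c * norm x)\<^sup>2"
    by (simp only: of_real_eq_iff)
  then show ?thesis by simp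
qed

text \<open>Rotating \<open>x\<close> by a phase makes the inner product real without changing the norms.\<close>

lemma cinner_Cauchy_Schwarz: "cmod (cinner x y) \<le> norm x * norm (y::'a::complex_inner)"
proof (cases "cinner x y = 0")
  case False
  define c where "c = cnj (cinner x y) / cmod (cinner x y)"
  have c: "cmod c = 1" using False by (simp add: c_def norm_divide)
  have "cinner (c *\<^sub>C x) y = cmod (cinner x y)"
    using False complex_norm_square[of "cinner x y"]
    by (simp add: cinner_scaleC_left c_def field_simps power2_eq_square)
  then have "cmod (cinner x y) = Re (cinner (c *\<^sub>C x) y)" by simp
  also have "\<dots> \<le> norm (c *\<^sub>C x) * norm y" using Re_cinner_le[of "c *\<^sub>C x" y] by linarith
  finally show ?thesis by (simp add: norm_scaleC c)
qed simp

lemma bounded_bilinear_cinner: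
  "bounded_bilinear (cinner :: 'a::complex_inner \<Rightarrow> 'a \<Rightarrow> complex)"
proof
  show "\<exists>K. \<forall>(x::'a) y. cmod (cinner x y) \<le> norm x * norm y * K"
    using cinner_Cauchy_Schwarz by (metis mult.right_neutral)
qed (simp_all add: cinner_add_left cinner_add_right cinner_scaleR_left cinner_scaleR_right
    scaleR_conv_of_real)

interpretation cinner: bounded_bilinear "cinner :: 'a::complex_inner \<Rightarrow> 'a \<Rightarrow> complex"
  by (rule bounded_bilinear_cinner)

declare cinner.zero_left [simp] cinner.zero_right [simp]

lemma cinner_eq_right: "(\<And>z. cinner z x = cinner z y) \<Longrightarrow> x = (y::'a::complex_inner)"
proof -
  assume "\<And>z. cinner z x = cinner z y"
  then have "cinner (x - y) (x - y) = 0" by (simp add: cinner.diff_right)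
  then show "x = y" by (simp add: cinner_self)
qed

lemma cinner_eq_left: "(\<And>z. cinner x z = cinner y z) \<Longrightarrow> x = (y::'a::complex_inner)"
  by (metis cinner_eq_right cinner_commute)

lemma parallelogram:
  fixes x y :: "'a::complex_inner"
  shows "(norm (x - y))\<^sup>2 = 2 * (norm x)\<^sup>2 + 2 * (norm y)\<^sup>2 - 4 * (norm ((1/2) *\<^sub>R (x + y)))\<^sup>2"
  using norm_add_scaleR_square[of x 1 y] norm_add_scaleR_square[of x "-1" y]
  by (simp add: power_divide add_divide_distrib del: scaleR_right_distrib scaleR_add_right)

text \<open>
  As \<open>x\<close> is a unit vector, \<open>a \<mapsto> 2\<langle>a,x\<rangle>x - a\<close> is a reflection, hence isometric; the inequality is
  Cauchy-Schwarz for the reflected vector and \<open>b\<close>.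
\<close>

lemma Buzano_inequality:
  fixes a b x :: "'a::complex_inner"
  assumes "norm x = 1"
  shows "cmod (cinner a x * cinner x b) \<le> (norm a * norm b + cmod (cinner a b)) / 2"
proof -
  define z where "z = (2 * cinner a x) *\<^sub>C x - a"
  have "cinner z z = cinner a a"
    unfolding z_def using assms cinner_commute[of x a]
    by (simp add: cinner.diff_left cinner.diff_right cinner_scaleC_left cinner_scaleC_right
        cinner_self[of x] algebra_simps)
  then have "norm z = norm a"
    by (metis Re_cinner_self norm_ge_zero power2_eq_iff_nonneg)
  have "2 * (cinner a x * cinner x b) = cinner z b + cinner a b"
    by (simp add: z_def cinner.diff_left cinner_scaleC_left)
  then have "2 * cmod (cinner a x * cinner x b) = cmod (cinner z b + cinner a b)"
    by (metis norm_mult norm_numeral)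
  also have "\<dots> \<le> norm z * norm b + cmod (cinner a b)"
    by (intro norm_triangle_le add_right_mono cinner_Cauchy_Schwarz)
  finally show ?thesis using \<open>norm z = norm a\<close> by simp
qed

section \<open>Riesz representation and adjoints\<close>

text \<open>
  The representing vector is the minimiser of \<open>\<parallel>x\<parallel>\<^sup>2 - 2 l x\<close>: the parallelogram law makes every
  minimising sequence Cauchy, and the first variation at the minimum is the representation.
\<close>

lemma Riesz_representation:
  fixes l :: "'a::chilbert_space \<Rightarrow> real"
  assumes "bounded_linear l"
  obtains z where "\<And>x. l x = Re (cinner x z)"
proof -
  interpret l: bounded_linear l by fact
  define J where "J x = (norm x)\<^sup>2 - 2 * l x" for x
  define m where "m = Inf (range J)"
  obtain K where K: "\<And>x. norm (l x) \<le> norm x * K" using l.bounded by blast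
  have "- (K\<^sup>2) \<le> J x" for x
  proof -
    have "2 * l x \<le> 2 * (norm x * K)" using K[of x] by simp
    moreover have "0 \<le> (norm x - K)\<^sup>2" by simp
    ultimately show ?thesis by (simp add: J_def power2_diff)
  qed
  then have bdd: "bdd_below (range J)" by (intro bdd_belowI2[of _ "- (K\<^sup>2)"])
  have m: "m \<le> J x" for x unfolding m_def by (intro cInf_lower bdd) simp
  have "\<exists>x. J x < m + 1 / real (Suc n)" for n
    using cInf_lessD[of "range J" "m + 1 / real (Suc n)"] by (auto simp: m_def)
  then obtain X where X: "\<And>n. J (X n) < m + 1 / real (Suc n)" by metis
  have dist: "(norm (X i - X j))\<^sup>2 \<le> 2 / real (Suc i) + 2 / real (Suc j)" for i j
  proof -
    have "(norm (X i - X j))\<^sup>2 = 2 * J (X i) + 2 * J (X j) - 4 * J ((1/2) *\<^sub>R (X i + X j))"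
      unfolding parallelogram by (simp add: J_def l.scaleR l.add field_simps)
    also have "\<dots> \<le> 2 / real (Suc i) + 2 / real (Suc j)"
      using X[of i] X[of j] m[of "(1/2) *\<^sub>R (X i + X j)"] by simp
    finally show ?thesis .
  qed
  have "Cauchy X"
  proof (rule metric_CauchyI)
    fix e :: real assume "e > 0"
    then obtain N where N: "inverse (real (Suc N)) < e\<^sup>2 / 4"
      using reals_Archimedean[of "e\<^sup>2 / 4"] by auto
    have "dist (X i) (X j) < e" if "N \<le> i" "N \<le> j" for i j
    proof -
      have "2 / real (Suc i) \<le> 2 / real (Suc N)" "2 / real (Suc j) \<le> 2 / real (Suc N)"
        using that by (auto intro!: divide_left_mono)
      then have "(norm (X i - X j))\<^sup>2 < e\<^sup>2"
        using dist[of i j] N by (simp add: inverse_eq_divide)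
      then show ?thesis
        using \<open>e > 0\<close> by (auto simp: dist_norm intro: power2_less_imp_less)
    qed
    then show "\<exists>M. \<forall>i\<ge>M. \<forall>j\<ge>M. dist (X i) (X j) < e" by blast
  qed
  then obtain z where z: "X \<longlonglongrightarrow> z" using Cauchy_convergent convergent_def by blast
  have "(\<lambda>n. J (X n)) \<longlonglongrightarrow> J z" unfolding J_def by (intro tendsto_intros z l.tendsto)
  moreover have "(\<lambda>n. m + 1 / real (Suc n)) \<longlonglongrightarrow> m + 0"
    by (intro tendsto_intros LIMSEQ_Suc[OF lim_const_over_n])
  ultimately have "J z \<le> m + 0"
    by (rule LIMSEQ_le) (use X in \<open>auto intro: less_imp_le\<close>)
  then have Jz: "J z \<le> m" by simp
  have "l x = Re (cinner x z)" for x
  proof -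
    define d where "d = Re (cinner z x) - l x"
    define s where "s = 1 + (norm x)\<^sup>2"
    have s: "s > 0" by (simp add: s_def add_pos_nonneg)
    have "J (z + t *\<^sub>R x) = J z + 2 * t * d + t\<^sup>2 * (norm x)\<^sup>2" for t
      by (simp add: J_def norm_add_scaleR_square l.add l.scaleR d_def algebra_simps)
    moreover have "J z \<le> J (z + (- d / s) *\<^sub>R x)" using Jz m order_trans by blast
    ultimately have "J z \<le> J z + 2 * (- d / s) * d + (- d / s)\<^sup>2 * (norm x)\<^sup>2"
      by metis
    then have "0 \<le> 2 * (- d / s) * d + (d / s)\<^sup>2 * (norm x)\<^sup>2"
      by (simp add: power_divide)
    also have "\<dots> \<le> 2 * (- d / s) * d + (d / s)\<^sup>2 * s"
      by (intro add_left_mono mult_left_mono) (auto simp: s_def)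
    also have "\<dots> = - (d\<^sup>2 / s)" using s by (simp add: field_simps power2_eq_square)
    finally have "d = 0" using s by (simp add: divide_le_0_iff)
    then show ?thesis by (simp add: d_def Re_cinner_commute)
  qed
  then show ?thesis by (rule that)
qed

lemma Re_cinner_i: "Re (cinner (\<i> *\<^sub>C x) y) = - Im (cinner x y)"
  by (simp add: cinner_scaleC_left)

lemma cadjoint_exists:
  fixes S :: "'a::chilbert_space \<Rightarrow>\<^sub>L 'b::chilbert_space"
  assumes S: "clinear_op S"
  shows "\<exists>R :: 'b \<Rightarrow>\<^sub>L 'a. \<forall>x y. cinner (S x) y = cinner x (R y)"
proof -
  have "\<exists>z. \<forall>x. Re (cinner (S x) y) = Re (cinner x z)" for y
  proof -
    have "bounded_linear (\<lambda>x. Re (cinner (S x) y))"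
      by (rule bounded_linear_compose[OF bounded_linear_Re
            bounded_linear_compose[OF cinner.bounded_linear_left blinfun.bounded_linear_right]])
    then show ?thesis by (metis Riesz_representation)
  qed
  then obtain R where R: "\<And>y x. Re (cinner (S x) y) = Re (cinner x (R y))" by metis
  have eq: "cinner (S x) y = cinner x (R y)" for x y
  proof (rule complex_eqI)
    show "Im (cinner (S x) y) = Im (cinner x (R y))"
      using R[of "\<i> *\<^sub>C x" y] S by (simp add: clinear_op_def Re_cinner_i)
  qed (rule R)
  have "bounded_linear R"
  proof (rule bounded_linear_intro[where K = "norm S"])
    show "R (x + y) = R x + R y" for x y
      by (rule cinner_eq_right) (simp add: eq[symmetric] cinner.add_right)
    show "R (r *\<^sub>R x) = r *\<^sub>R R x" for r x
      by (rule cinner_eq_right) (simp add: eq[symmetric] cinner_scaleR_right)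
    fix y
    have "(norm (R y))\<^sup>2 = Re (cinner (S (R y)) y)" by (simp add: eq)
    also have "\<dots> \<le> norm (S (R y)) * norm y" using Re_cinner_le abs_le_D1 by blast
    also have "\<dots> \<le> (norm S * norm (R y)) * norm y" by (intro mult_right_mono norm_blinfun) simp
    finally have "norm (R y) * norm (R y) \<le> norm (R y) * (norm y * norm S)"
      by (simp add: power2_eq_square mult_ac)
    then show "norm (R y) \<le> norm y * norm S"
      by (cases "R y = 0") (simp_all add: mult_le_cancel_left)
  qed
  then have "\<forall>x y. cinner (S x) y = cinner x (Blinfun R y)"
    by (simp add: bounded_linear_Blinfun_apply eq)
  then show ?thesis by blast
qed

lemma cadjoint_unique:
  fixes S :: "'a::chilbert_space \<Rightarrow>\<^sub>L 'b::chilbert_space" and R :: "'b \<Rightarrow>\<^sub>L 'a"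
  assumes "\<And>x y. cinner (S x) y = cinner x (R y)"
  shows "cadjoint S = R"
  unfolding cadjoint_def
proof (rule the_equality)
  fix R' :: "'b \<Rightarrow>\<^sub>L 'a" assume "\<forall>x y. cinner (S x) y = cinner x (R' y)"
  then show "R' = R" by (intro blinfun_eqI cinner_eq_right) (simp add: assms[symmetric])
qed (simp add: assms)

lemma cinner_cadjoint: "clinear_op S \<Longrightarrow> cinner (S x) y = cinner x (cadjoint S y)"
  using cadjoint_exists[of S] cadjoint_unique[of S] by metis

lemma cinner_cadjoint': "clinear_op S \<Longrightarrow> cinner (cadjoint S x) y = cinner x (S y)"
  by (metis cinner_cadjoint cinner_commute)

lemma clinear_cadjoint:
  assumes "clinear_op S"
  shows "clinear_op (cadjoint S)"
  unfolding clinear_op_def[of "cadjoint S"]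
  by (intro allI cinner_eq_right)
    (simp add: cinner_cadjoint[OF assms, symmetric] cinner_scaleC_right)

lemma cadjoint_cadjoint: "clinear_op S \<Longrightarrow> cadjoint (cadjoint S) = S"
  by (intro cadjoint_unique cinner_cadjoint')


section \<open>Self-adjoint and positive operators\<close>

definition selfadjoint_op :: "('a::complex_inner \<Rightarrow>\<^sub>L 'a) \<Rightarrow> bool"
  where "selfadjoint_op S \<longleftrightarrow> (\<forall>x y. cinner (S x) y = cinner x (S y))"

definition positive_op :: "('a::complex_inner \<Rightarrow>\<^sub>L 'a) \<Rightarrow> bool"
  where "positive_op S \<longleftrightarrow> selfadjoint_op S \<and> (\<forall>x. 0 \<le> Re (cinner (S x) x))"

lemma selfadjoint_opD: "selfadjoint_op S \<Longrightarrow> cinner (S x) y = cinner x (S y)"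
  by (simp add: selfadjoint_op_def)

lemma positive_op_selfadjoint: "positive_op S \<Longrightarrow> selfadjoint_op S"
  and positive_op_nonneg: "positive_op S \<Longrightarrow> 0 \<le> Re (cinner (S x) x)"
  by (simp_all add: positive_op_def)

lemma Re_cinner_selfadjoint_twice:
  "selfadjoint_op S \<Longrightarrow> Re (cinner (S (S x)) x) = (norm (S x))\<^sup>2"
  by (simp only: selfadjoint_opD[of S "S x" x] Re_cinner_self)

lemma selfadjoint_clinear: "selfadjoint_op S \<Longrightarrow> clinear_op S"
  unfolding clinear_op_def
  by (intro allI cinner_eq_left) (simp add: selfadjoint_opD cinner_scaleC_left)

lemma selfadjoint_cinner_real:
  "selfadjoint_op S \<Longrightarrow> cinner (S x) x = complex_of_real (Re (cinner (S x) x))"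
proof -
  assume "selfadjoint_op S"
  then have "cinner (S x) x = cnj (cinner (S x) x)"
    by (metis selfadjoint_opD cinner_commute)
  then show ?thesis by (metis Reals_cnj_iff of_real_Re)
qed

lemma positive_cadjoint_compose:
  assumes "clinear_op S"
  shows "positive_op (cadjoint S o\<^sub>L S)" 
  using assms
  by (simp add: positive_op_def selfadjoint_op_def cinner_cadjoint'
      cinner_cadjoint[symmetric])

lemma Re_cinner_le_norm:
  fixes S :: "'a::complex_inner \<Rightarrow>\<^sub>L 'a"
  shows "Re (cinner (S x) x) \<le> norm S * (norm x)\<^sup>2"
proof -
  have "Re (cinner (S x) x) \<le> norm (S x) * norm x" using Re_cinner_le abs_le_D1 by blast
  also have "\<dots> \<le> (norm S * norm x) * norm x" by (intro mult_right_mono norm_blinfun) simp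
  finally show ?thesis by (simp add: power2_eq_square mult.assoc)
qed

text \<open>
  For small \<open>\<rho> > 0\<close> the map \<open>x \<mapsto> x - \<rho> (T x - y)\<close> is a contraction, because
  \<open>\<parallel>x - \<rho> T x\<parallel>\<^sup>2 = \<parallel>x\<parallel>\<^sup>2 - 2 \<rho> Re \<langle>T x, x\<rangle> + \<rho>\<^sup>2 \<parallel>T x\<parallel>\<^sup>2\<close>; its fixed point solves \<open>T x = y\<close>.
\<close>

lemma coercive_surj:
  fixes T :: "'a::chilbert_space \<Rightarrow>\<^sub>L 'a"
  assumes c: "c > 0" and T: "\<And>x. c * (norm x)\<^sup>2 \<le> Re (cinner (T x) x)"
  shows "\<exists>x. T x = y"
proof -
  define M where "M = norm T + 1"
  \<comment> \<open>The value of \<open>\<rho>\<close> that minimises the bound \<open>1 - 2 \<rho> c + \<rho>\<^sup>2 M\<^sup>2\<close>, with minimum \<open>1 - c\<^sup>2 / M\<^sup>2\<close>.\<close>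
  define \<rho> where "\<rho> = c / M\<^sup>2"
  \<comment> \<open>The maximum differs from its second argument only on the zero space, where \<open>c\<close> may exceed \<open>M\<close>.\<close>
  define k where "k = max 0 (1 - c\<^sup>2 / M\<^sup>2)"
  have M: "M > 0" by (simp add: M_def add_nonneg_pos)
  have \<rho>: "\<rho> > 0" using c M by (simp add: \<rho>_def)
  have k: "0 \<le> k" "k < 1" using c M by (auto simp: k_def)
  have *: "(norm (x - \<rho> *\<^sub>R T x))\<^sup>2 \<le> k * (norm x)\<^sup>2" for x
  proof -
    have "norm (T x) \<le> M * norm x"
      using norm_blinfun[of T x] by (simp add: M_def algebra_simps add_increasing)
    then have "(norm (T x))\<^sup>2 \<le> M\<^sup>2 * (norm x)\<^sup>2"
      by (metis norm_ge_zero power_mono power_mult_distrib)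
    then have "\<rho>\<^sup>2 * (norm (T x))\<^sup>2 \<le> \<rho>\<^sup>2 * (M\<^sup>2 * (norm x)\<^sup>2)" by (intro mult_left_mono) auto
    moreover have "2 * \<rho> * (c * (norm x)\<^sup>2) \<le> 2 * \<rho> * Re (cinner (T x) x)"
      using \<rho> T by (intro mult_left_mono) auto
    moreover have "\<rho>\<^sup>2 * (M\<^sup>2 * (norm x)\<^sup>2) = \<rho> * (c * (norm x)\<^sup>2)"
      using M by (simp add: \<rho>_def power2_eq_square)
    moreover have "\<rho> * (c * (norm x)\<^sup>2) = c\<^sup>2 / M\<^sup>2 * (norm x)\<^sup>2"
      by (simp add: \<rho>_def power2_eq_square)
    ultimately have "(norm (x - \<rho> *\<^sub>R T x))\<^sup>2 \<le> (1 - c\<^sup>2 / M\<^sup>2) * (norm x)\<^sup>2"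
      using norm_add_scaleR_square[of x "- \<rho>" "T x"] Re_cinner_commute[of x "T x"]
      by (simp add: algebra_simps)
    also have "\<dots> \<le> k * (norm x)\<^sup>2" by (intro mult_right_mono) (auto simp: k_def)
    finally show ?thesis .
  qed
  define f where "f x = x - \<rho> *\<^sub>R (T x - y)" for x
  have "dist (f x) (f z) \<le> sqrt k * dist x z" for x z
  proof -
    have "f x - f z = (x - z) - \<rho> *\<^sub>R T (x - z)"
      by (simp add: f_def blinfun.diff_right algebra_simps)
    then have "(norm (f x - f z))\<^sup>2 \<le> (sqrt k * norm (x - z))\<^sup>2"
      using *[of "x - z"] k by (simp add: power_mult_distrib)
    then show ?thesis
      unfolding dist_norm by (rule power2_le_imp_le) (use k in simp)
  qed
  moreover have "0 \<le> sqrt k" "sqrt k < 1" using k by auto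
  ultimately obtain x where "f x = x" using banach_fix_type[of "sqrt k" f] by auto
  then show ?thesis using \<rho> by (auto simp: f_def)
qed

lemma coercive_inverse:
  fixes T :: "'a::chilbert_space \<Rightarrow>\<^sub>L 'a"
  assumes c: "c > 0" and T: "\<And>x. c * (norm x)\<^sup>2 \<le> Re (cinner (T x) x)"
  shows "\<exists>R :: 'a \<Rightarrow>\<^sub>L 'a. (\<forall>x. R (T x) = x) \<and> (\<forall>x. T (R x) = x)"
proof -
  have inj: "x = z" if "T x = T z" for x z
  proof -
    have "c * (norm (x - z))\<^sup>2 \<le> 0"
      using T[of "x - z"] that by (simp add: blinfun.diff_right)
    then show ?thesis using c by (simp add: mult_le_0_iff)
  qed
  obtain R where R: "\<And>y. T (R y) = y" using coercive_surj[OF assms] by metis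
  have "bounded_linear R"
  proof (rule bounded_linear_intro[where K = "1 / c"])
    show "R (x + y) = R x + R y" for x y by (rule inj) (simp add: R blinfun.add_right)
    show "R (r *\<^sub>R x) = r *\<^sub>R R x" for r x by (rule inj) (simp add: R blinfun.scaleR_right)
    fix y
    have "c * (norm (R y))\<^sup>2 \<le> Re (cinner y (R y))" using T[of "R y"] by (simp add: R)
    also have "\<dots> \<le> norm y * norm (R y)" using Re_cinner_le abs_le_D1 by blast
    finally have "norm (R y) * (c * norm (R y)) \<le> norm (R y) * norm y"
      by (simp add: power2_eq_square mult_ac)
    then have "c * norm (R y) \<le> norm y"
      by (cases "R y = 0") (simp_all add: mult_le_cancel_left)
    then show "norm (R y) \<le> norm y * (1 / c)" using c by (simp add: field_simps)
  qed
  then have "(\<forall>x. Blinfun R (T x) = x) \<and> (\<forall>x. T (Blinfun R x) = x)"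
    using inj by (simp add: bounded_linear_Blinfun_apply R)
  then show ?thesis by blast
qed

text \<open>
  The functional calculus depends only on the real points of the spectrum; nonreal roots of a
  polynomial are handled in conjugate pairs, without a resolvent at the single root.
\<close>

definition real_spectrum :: "('a::chilbert_space \<Rightarrow>\<^sub>L 'a) \<Rightarrow> real set"
  where "real_spectrum S = {t. complex_of_real t \<in> op_spectrum S}"

lemma not_in_real_spectrumD:
  assumes "t \<notin> real_spectrum S"
  shows "\<exists>R :: 'a::chilbert_space \<Rightarrow>\<^sub>L 'a. \<forall>x. R (t *\<^sub>R x - S x) = x"
  using assms by (auto simp: real_spectrum_def op_spectrum_def scaleC_of_real)

text \<open>
  A resolvent has to be complex-linear by the definition of the spectrum; for a real-linear inverse
  of a complex-linear operator this is automatic.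
\<close>

lemma real_spectrumI:
  fixes S R :: "'a::chilbert_space \<Rightarrow>\<^sub>L 'a"
  assumes S: "clinear_op S"
    and R: "\<And>x. R (t *\<^sub>R x - S x) = x" "\<And>x. t *\<^sub>R R x - S (R x) = x"
  shows "t \<notin> real_spectrum S"
proof -
  have "R (d *\<^sub>C x) = d *\<^sub>C R x" for d x
  proof -
    have "d *\<^sub>C x = d *\<^sub>C (t *\<^sub>R R x + - S (R x))" by (simp add: R)
    also have "\<dots> = t *\<^sub>R (d *\<^sub>C R x) - S (d *\<^sub>C R x)"
    proof -
      have "d *\<^sub>C (- z) = - (d *\<^sub>C z)" for z :: 'a
        by (metis scaleC_scaleC scaleC_of_real scaleR_minus1_left of_real_minus of_real_1 mult.commute)
      moreover have "d *\<^sub>C (t *\<^sub>R z) = t *\<^sub>R (d *\<^sub>C z)" for z :: 'a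
        by (metis scaleC_scaleC scaleC_of_real mult.commute)
      ultimately show ?thesis using S by (simp only: scaleC_add_right clinear_op_def) simp
    qed
    finally show ?thesis by (simp add: R)
  qed
  then have "clinear_op R" by (simp add: clinear_op_def)
  with R show ?thesis by (auto simp: real_spectrum_def op_spectrum_def scaleC_of_real)
qed

text \<open>The sign \<open>e\<close> serves the points above the numerical range (\<open>e = 1\<close>) and those below it (\<open>e = -1\<close>).\<close>

lemma coercive_resolvent:
  fixes S :: "'a::chilbert_space \<Rightarrow>\<^sub>L 'a"
  assumes "clinear_op S" "c > 0" "\<bar>e\<bar> = 1"
    and T: "\<And>x. c * (norm x)\<^sup>2 \<le> Re (cinner (e *\<^sub>R (t *\<^sub>R x - S x)) x)"
  shows "t \<notin> real_spectrum S"
proof -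
  define T where "T = e *\<^sub>R (t *\<^sub>R id_blinfun - S)"
  have Tx: "T x = e *\<^sub>R (t *\<^sub>R x - S x)" for x
    by (simp add: T_def blinfun.scaleR_left blinfun.diff_left)
  obtain R :: "'a \<Rightarrow>\<^sub>L 'a" where R: "\<And>x. R (T x) = x" "\<And>x. T (R x) = x"
    using coercive_inverse[OF \<open>c > 0\<close>, of T] assms(4) unfolding Tx by blast
  have "e * e = 1" using \<open>\<bar>e\<bar> = 1\<close> by (metis abs_mult_self_eq mult_1)
  then show ?thesis
    using R(1) R(2)[of "e *\<^sub>R _"] assms(1)
    by (intro real_spectrumI[of S "R o\<^sub>L (e *\<^sub>R id_blinfun)"])
      (auto simp: Tx blinfun.scaleR_left blinfun.scaleR_right blinfun.diff_right algebra_simps)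
qed

lemma positive_real_spectrum:
  assumes S: "positive_op S"
  shows "real_spectrum S \<subseteq> {0..norm S}"
proof
  fix t assume t: "t \<in> real_spectrum S"
  have cl: "clinear_op S" using S positive_op_selfadjoint selfadjoint_clinear by blast
  have "\<not> t < 0"
  proof
    assume "t < 0"
    then have "t \<notin> real_spectrum S"
      using positive_op_nonneg[OF S]
      by (intro coercive_resolvent[OF cl, of "- t" "-1"])
        (auto simp: cinner.diff_left cinner_scaleR_left cinner.minus_left)
    with t show False by simp
  qed
  moreover have "\<not> norm S < t"
  proof
    assume less: "norm S < t"
    have "t \<notin> real_spectrum S" using less Re_cinner_le_norm[of S]
      by (intro coercive_resolvent[OF cl, of "t - norm S" 1])
        (auto simp: cinner.diff_left cinner_scaleR_left algebra_simps)
    with t show False by simp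
  qed
  ultimately show "t \<in> {0..norm S}" by simp
qed

section \<open>Polynomials in an operator\<close>

lemma op_poly_atMost:
  assumes "degree p \<le> n"
  shows "op_poly p S = (\<Sum>i\<le>n. coeff p i *\<^sub>R ((\<lambda>R. S o\<^sub>L R) ^^ i) id_blinfun)"
  unfolding op_poly_def using assms
  by (intro sum.mono_neutral_left) (auto simp: coeff_eq_0)

lemma op_poly_0 [simp]: "op_poly 0 S = 0"
  by (simp add: op_poly_def)

lemma op_poly_pCons [simp]: "op_poly (pCons a p) S = a *\<^sub>R id_blinfun + (S o\<^sub>L op_poly p S)"
proof -
  have "op_poly (pCons a p) S =
      (\<Sum>i\<le>Suc (degree p). coeff (pCons a p) i *\<^sub>R ((\<lambda>R. S o\<^sub>L R) ^^ i) id_blinfun)"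
    by (rule op_poly_atMost) (rule degree_pCons_le)
  also have "\<dots> = a *\<^sub>R id_blinfun + (S o\<^sub>L op_poly p S)"
    by (simp add: sum.atMost_Suc_shift op_poly_def del: sum.atMost_Suc)
      (simp add: bounded_bilinear.sum_right[OF bounded_bilinear_blinfun_compose]
        bounded_bilinear.scaleR_right[OF bounded_bilinear_blinfun_compose])
  finally show ?thesis .
qed

lemma op_poly_add: "op_poly (p + q) S = op_poly p S + op_poly q S"
proof (induction p q rule: poly_induct2)
  case (pCons a p b q)
  then show ?case
    by (intro blinfun_eqI) (simp add: blinfun.bilinear_simps algebra_simps)
qed simp

lemma op_poly_smult: "op_poly (smult c p) S = c *\<^sub>R op_poly p S"
  by (induction p) (auto intro!: blinfun_eqI simp: blinfun.bilinear_simps algebra_simps)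

lemma op_poly_diff: "op_poly (p - q) S = op_poly p S - op_poly q S"
  using op_poly_add[of p "- q" S] op_poly_smult[of "- 1" q S] by simp

lemma op_poly_mult: "op_poly (p * q) S = op_poly p S o\<^sub>L op_poly q S"
  by (induction p)
    (auto intro!: blinfun_eqI simp: op_poly_add op_poly_smult blinfun.bilinear_simps)

lemma op_poly_intertwine:
  fixes S :: "'a::real_normed_vector \<Rightarrow>\<^sub>L 'a" and T :: "'b::real_normed_vector \<Rightarrow>\<^sub>L 'b"
    and A :: "'a \<Rightarrow>\<^sub>L 'b"
  assumes "\<And>x. A (S x) = T (A x)"
  shows "A (op_poly p S x) = op_poly p T (A x)"
  by (induction p arbitrary: x) (auto simp: blinfun.bilinear_simps assms)

lemma op_poly_selfadjoint: "selfadjoint_op S \<Longrightarrow> selfadjoint_op (op_poly p S)"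
proof (induction p)
  case (pCons a p)
  have "S (op_poly p S x) = op_poly p S (S x)" for x
    by (rule op_poly_intertwine) simp
  with pCons show ?case
    by (simp add: selfadjoint_op_def blinfun.bilinear_simps cinner.add_left cinner.add_right
        cinner_scaleR_left cinner_scaleR_right)
qed (simp add: selfadjoint_op_def)


section \<open>The norm of a polynomial in a self-adjoint operator\<close>

lemma poly_of_real_mult:
  "poly (map_poly complex_of_real (p * q)) z =
    poly (map_poly complex_of_real p) z * poly (map_poly complex_of_real q) z"
proof -
  have add: "map_poly complex_of_real (a + b) = map_poly complex_of_real a + map_poly complex_of_real b"
    for a b by (rule poly_eqI) (simp add: coeff_map_poly)
  have smult: "map_poly complex_of_real (smult c a) = smult (complex_of_real c) (map_poly complex_of_real a)"
    for c a by (rule poly_eqI) (simp add: coeff_map_poly)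
  show ?thesis
    by (induction p) (simp_all add: add smult map_poly_pCons algebra_simps)
qed

lemma poly_map_poly_of_real:
  "poly (map_poly complex_of_real p) (complex_of_real t) = complex_of_real (poly p t)"
  by (induction p) (simp_all add: map_poly_pCons)

lemma poly_of_real_add:
  "poly (map_poly complex_of_real (p + q)) z =
    poly (map_poly complex_of_real p) z + poly (map_poly complex_of_real q) z"
proof -
  have "map_poly complex_of_real (p + q) = map_poly complex_of_real p + map_poly complex_of_real q"
    by (rule poly_eqI) (simp add: coeff_map_poly)
  then show ?thesis by simp
qed

text \<open>
  Over the reals every nonconstant polynomial has a linear factor or a quadratic factor
  \<open>(t - a)\<^sup>2 + b\<^sup>2\<close>, according to whether a given complex root is real.
\<close>

lemma real_poly_factor:
  fixes q :: "real poly"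
  assumes "degree q \<noteq> 0"
  obtains (linear) a q' where "q = [:- a, 1:] * q'"
  | (quadratic) a b q' where "b \<noteq> 0" "q = [:a\<^sup>2 + b\<^sup>2, - 2 * a, 1:] * q'"
proof -
  have "degree (map_poly complex_of_real q) \<noteq> 0"
    using assms by (simp add: degree_map_poly)
  then obtain z where z: "poly (map_poly complex_of_real q) z = 0"
    using fundamental_theorem_of_algebra constant_degree by metis
  show ?thesis
  proof (cases "Im z = 0")
    case True
    then have "z = complex_of_real (Re z)" by (simp add: complex_eq_iff)
    then have "complex_of_real (poly q (Re z)) = 0"
      using z by (metis poly_map_poly_of_real)
    then have "[:- Re z, 1:] dvd q" by (simp add: poly_eq_0_iff_dvd)
    then show ?thesis using linear by (auto elim: dvdE)
  next
    case False
    define d where "d = [:(Re z)\<^sup>2 + (Im z)\<^sup>2, - 2 * Re z, 1:]"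
    define s where "s = q mod d"
    have d: "poly (map_poly complex_of_real d) z = 0"
      by (simp add: d_def map_poly_pCons complex_eq_iff power2_eq_square algebra_simps)
    have "degree s \<le> 1"
      using degree_mod_less'[of d q] by (cases "s = 0") (auto simp: s_def d_def)
    moreover obtain u t where "s = pCons u t" by (cases s)
    ultimately have "degree t = 0" by (simp add: degree_pCons_eq_if split: if_splits)
    then obtain v where "t = [:v:]" by (rule degree_eq_zeroE)
    with \<open>s = pCons u t\<close> have s: "s = [:u, v:]" by simp
    have "q = d * (q div d) + s" by (simp add: s_def)
    then have "poly (map_poly complex_of_real s) z = 0"
      using z d by (metis poly_of_real_add poly_of_real_mult add_0 mult_zero_left)
    then have "u + Re z * v = 0 \<and> Im z * v = 0"
      by (simp add: s map_poly_pCons complex_eq_iff)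
    then have "s = 0" using False by (auto simp: s)
    then have "q = d * (q div d)" by (simp add: s_def mod_eq_0_iff_dvd)
    with quadratic[OF False] show ?thesis by (simp add: d_def)
  qed
qed

text \<open>
  Factor by factor: a linear factor \<open>t - a\<close> is invertible since \<open>a\<close> is outside the spectrum, and
  \<open>(S - a)\<^sup>2 + b\<^sup>2\<close> is bounded below by \<open>b\<^sup>2\<close>, hence coercive.
\<close>

lemma op_poly_left_inverse:
  fixes S :: "'a::chilbert_space \<Rightarrow>\<^sub>L 'a"
  assumes S: "selfadjoint_op S" and "q \<noteq> 0"
    and "\<And>t. t \<in> real_spectrum S \<Longrightarrow> poly q t \<noteq> 0"
  shows "\<exists>R :: 'a \<Rightarrow>\<^sub>L 'a. \<forall>x. R (op_poly q S x) = x"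
  using assms(2,3)
proof (induction "degree q" arbitrary: q rule: less_induct)
  case less
  have step: ?case
    if q: "q = d * q'" and d: "degree d > 0"
      and D: "\<forall>x. D (op_poly d S x) = x" for d q' and D :: "'a \<Rightarrow>\<^sub>L 'a"
  proof -
    have "q' \<noteq> 0" "d \<noteq> 0" using less.prems(1) q by auto
    then have "degree q' < degree q" using d by (simp add: q degree_mult_eq)
    moreover have "poly q' t \<noteq> 0" if "t \<in> real_spectrum S" for t
      using less.prems(2)[OF that] q by auto
    ultimately obtain R :: "'a \<Rightarrow>\<^sub>L 'a" where R: "\<forall>x. R (op_poly q' S x) = x"
      using less.hyps \<open>q' \<noteq> 0\<close> by blast
    have "\<forall>x. (R o\<^sub>L D) (op_poly q S x) = x"
      using D R by (simp add: q op_poly_mult)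
    then show ?thesis by blast
  qed
  show ?case
  proof (cases "degree q = 0")
    case True
    then obtain c where "q = [:c:]" by (meson degree_eq_zeroE)
    then have "\<forall>x. ((1 / c) *\<^sub>R id_blinfun) (op_poly q S x) = x"
      using less.prems(1) by (simp add: blinfun.bilinear_simps)
    then show ?thesis by blast
  next
    case False
    then show ?thesis
    proof (cases rule: real_poly_factor)
      case (linear a q')
      then have "a \<notin> real_spectrum S" using less.prems(2)[of a] by auto
      then obtain R :: "'a \<Rightarrow>\<^sub>L 'a" where R: "\<And>x. R (a *\<^sub>R x - S x) = x"
        using not_in_real_spectrumD by blast
      have "(- R) (op_poly [:- a, 1:] S x) = x" for x
        using R[of x] by (simp add: blinfun.bilinear_simps)
      then show ?thesis by (intro step[OF linear, of "- R"]) auto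
    next
      case (quadratic a b q')
      let ?d = "[:a\<^sup>2 + b\<^sup>2, - 2 * a, 1:]"
      have "b\<^sup>2 * (norm x)\<^sup>2 \<le> Re (cinner (op_poly ?d S x) x)" for x
      proof -
        have "Re (cinner (op_poly ?d S x) x) =
            (a\<^sup>2 + b\<^sup>2) * (norm x)\<^sup>2 - 2 * a * Re (cinner (S x) x) + Re (cinner (S (S x)) x)"
          by (simp add: blinfun.bilinear_simps cinner.add_left cinner_scaleR_left)
        also have "Re (cinner (S (S x)) x) = (norm (S x))\<^sup>2"
          by (rule Re_cinner_selfadjoint_twice[OF S])
        finally have "Re (cinner (op_poly ?d S x) x) = b\<^sup>2 * (norm x)\<^sup>2 + (norm (S x + (- a) *\<^sub>R x))\<^sup>2"
          unfolding norm_add_scaleR_square by (simp add: algebra_simps)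
        then show ?thesis by simp
      qed
      then obtain D :: "'a \<Rightarrow>\<^sub>L 'a" where "\<forall>x. D (op_poly ?d S x) = x"
        using coercive_inverse[of "b\<^sup>2" "op_poly ?d S"] quadratic(1) by auto
      then show ?thesis by (intro step[OF quadratic(2), of D]) auto
    qed
  qed
qed

text \<open>
  With \<open>M = \<parallel>T\<parallel>\<close>, the number \<open>M\<^sup>2\<close> is an approximate eigenvalue of \<open>T\<^sup>2\<close>: for a unit vector \<open>x\<close> one has
  \<open>\<parallel>M\<^sup>2 x - T\<^sup>2 x\<parallel>\<^sup>2 \<le> M\<^sup>2 (M\<^sup>2 - \<parallel>T x\<parallel>\<^sup>2)\<close>, which is as small as desired when \<open>\<parallel>T x\<parallel>\<close> is close to \<open>M\<close>.
  A bounded left inverse of \<open>M\<^sup>2 - T\<^sup>2\<close> would keep it away from zero, unless \<open>T = 0\<close>.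
\<close>

lemma norm_square_not_left_invertible:
  fixes T R :: "'a::chilbert_space \<Rightarrow>\<^sub>L 'a"
  assumes T: "selfadjoint_op T" and R: "\<And>x. R ((norm T)\<^sup>2 *\<^sub>R x - T (T x)) = x"
  shows "norm T = 0"
proof (rule ccontr)
  assume "norm T \<noteq> 0"
  define M where "M = norm T"
  define K where "K = norm R + 1"
  have M: "M > 0" using \<open>norm T \<noteq> 0\<close> by (simp add: M_def)
  have K: "K > 0" by (simp add: K_def add_nonneg_pos)
  define e where "e = 1 / (K\<^sup>2 * M\<^sup>2)"
  have e: "e > 0" using M K by (simp add: e_def)
  have main: "(norm (T x))\<^sup>2 \<le> (M\<^sup>2 - e) * (norm x)\<^sup>2" for x
  proof -
    let ?v = "M\<^sup>2 *\<^sub>R x - T (T x)"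
    have "norm x = norm (R ?v)" using R by (simp add: M_def)
    also have "\<dots> \<le> K * norm ?v"
      using norm_blinfun[of R ?v] by (simp add: K_def algebra_simps add_increasing)
    finally have bound: "(norm x)\<^sup>2 \<le> K\<^sup>2 * (norm ?v)\<^sup>2"
      by (metis norm_ge_zero power_mono power_mult_distrib)
    have "(norm ?v)\<^sup>2 = (norm (T (T x)))\<^sup>2 - 2 * M\<^sup>2 * (norm (T x))\<^sup>2 + M\<^sup>2 * M\<^sup>2 * (norm x)\<^sup>2"
      using norm_add_scaleR_square[of "T (T x)" "- M\<^sup>2" x]
      by (simp add: Re_cinner_selfadjoint_twice[OF T] norm_minus_commute mult_ac
          flip: power2_eq_square)
    moreover have "(norm (T (T x)))\<^sup>2 \<le> M\<^sup>2 * (norm (T x))\<^sup>2"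
      unfolding M_def by (metis norm_blinfun norm_ge_zero power_mono power_mult_distrib)
    ultimately have "(norm ?v)\<^sup>2 \<le> M\<^sup>2 * (M\<^sup>2 * (norm x)\<^sup>2 - (norm (T x))\<^sup>2)"
      by (simp add: algebra_simps)
    then have "K\<^sup>2 * (norm ?v)\<^sup>2 \<le> K\<^sup>2 * (M\<^sup>2 * (M\<^sup>2 * (norm x)\<^sup>2 - (norm (T x))\<^sup>2))"
      by (rule mult_left_mono) simp
    with bound have "(norm x)\<^sup>2 \<le> K\<^sup>2 * (M\<^sup>2 * (M\<^sup>2 * (norm x)\<^sup>2 - (norm (T x))\<^sup>2))"
      by (rule order_trans)
    then show ?thesis using M K by (simp add: e_def field_simps)
  qed
  have "M\<^sup>2 \<le> M\<^sup>2 - e"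
  proof (cases "M\<^sup>2 - e \<ge> 0")
    case True
    have "norm T \<le> sqrt (M\<^sup>2 - e)"
    proof (rule norm_blinfun_bound)
      show "norm (T x) \<le> sqrt (M\<^sup>2 - e) * norm x" for x
        by (rule power2_le_imp_le) (use True main in \<open>simp_all add: power_mult_distrib\<close>)
    qed (use True in simp)
    then show ?thesis
      using True M power_mono[of M "sqrt (M\<^sup>2 - e)" 2] by (simp add: M_def)
  next
    case False
    have "T x = 0" for x
    proof -
      have "(M\<^sup>2 - e) * (norm x)\<^sup>2 \<le> 0" using False by (simp add: mult_nonpos_nonneg)
      then show ?thesis using main[of x] by (metis norm_eq_zero order_trans power2_less_eq_zero_iff)
    qed
    then have "T = 0" by (intro blinfun_eqI) simp
    then show ?thesis using \<open>norm T \<noteq> 0\<close> by simp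
  qed
  then show False using e by simp
qed

text \<open>
  Writing \<open>M = \<parallel>p(S)\<parallel>\<close>, the operator \<open>M\<^sup>2 - p(S)\<^sup>2\<close> is a polynomial in \<open>S\<close> without left inverse, so
  \<open>M\<^sup>2 - p\<^sup>2\<close> has a root in the spectrum. If this polynomial is zero, any spectral value serves.
\<close>

lemma op_poly_norm_attained:
  fixes S :: "'a::chilbert_space \<Rightarrow>\<^sub>L 'a"
  assumes S: "selfadjoint_op S" and nz: "norm (op_poly p S) \<noteq> 0"
  shows "\<exists>t \<in> real_spectrum S. \<bar>poly p t\<bar> = norm (op_poly p S)"
proof -
  have root: "\<exists>t \<in> real_spectrum S. poly ([:(norm (op_poly p S))\<^sup>2:] - p * p) t = 0"
    if p: "norm (op_poly p S) \<noteq> 0" "[:(norm (op_poly p S))\<^sup>2:] - p * p \<noteq> 0" for p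
  proof (rule ccontr)
    assume "\<not> ?thesis"
    then obtain R :: "'a \<Rightarrow>\<^sub>L 'a" where
      R: "\<And>x. R (op_poly ([:(norm (op_poly p S))\<^sup>2:] - p * p) S x) = x"
      using op_poly_left_inverse[OF S p(2)] by auto
    have "norm (op_poly p S) = 0"
    proof (rule norm_square_not_left_invertible)
      show "selfadjoint_op (op_poly p S)" using S by (rule op_poly_selfadjoint)
      show "R ((norm (op_poly p S))\<^sup>2 *\<^sub>R x - op_poly p S (op_poly p S x)) = x" for x
        using R[of x] by (simp add: op_poly_diff op_poly_mult blinfun.bilinear_simps)
    qed
    with p(1) show False by simp
  qed
  have "\<exists>t \<in> real_spectrum S. poly ([:(norm (op_poly p S))\<^sup>2:] - p * p) t = 0"
  proof (cases "[:(norm (op_poly p S))\<^sup>2:] - p * p = 0")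
    case True
    \<comment> \<open>As \<open>p(S) \<noteq> 0\<close>, the space is not zero. Hence \<open>S\<close> or \<open>S + I\<close> is nonzero, and this is the value
        at \<open>S\<close> of a polynomial of degree 1, which yields a spectral value.\<close>
    have "real_spectrum S \<noteq> {}"
    proof -
      define c where "c = (if norm S = 0 then 1 else 0::real)"
      have "op_poly [:c, 1:] S \<noteq> 0"
      proof
        assume *: "op_poly [:c, 1:] S = 0"
        show False
        proof (cases "norm S = 0")
          case True
          then have "x = 0" for x :: 'a
            using arg_cong[OF *, of "\<lambda>R. R x"] by (simp add: c_def blinfun.bilinear_simps)
          then have "op_poly p S = 0" by (intro blinfun_eqI) metis
          then show False using nz by simp
        next
          case False
          then have "S x = 0" for x
            using arg_cong[OF *, of "\<lambda>R. R x"] by (simp add: c_def blinfun.bilinear_simps)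
          then have "S = 0" by (intro blinfun_eqI) simp
          then show False using False by simp
        qed
      qed
      then show ?thesis using root[of "[:c, 1:]"] by auto
    qed
    with True show ?thesis by auto
  qed (use root nz in blast)
  then obtain t where t: "t \<in> real_spectrum S" "(norm (op_poly p S))\<^sup>2 = (poly p t)\<^sup>2"
    by (auto simp: power2_eq_square)
  then have "\<bar>poly p t\<bar> = norm (op_poly p S)"
    by (metis abs_norm_cancel power2_eq_iff abs_minus)
  with t(1) show ?thesis by blast
qed

lemma norm_op_poly_le:
  fixes S :: "'a::chilbert_space \<Rightarrow>\<^sub>L 'a"
  assumes "selfadjoint_op S" and "0 \<le> e"
    and "\<And>t. t \<in> real_spectrum S \<Longrightarrow> \<bar>poly p t\<bar> \<le> e"
  shows "norm (op_poly p S) \<le> e"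
  using op_poly_norm_attained[OF assms(1), of p] assms(2,3)
  by (cases "norm (op_poly p S) = 0") force+


section \<open>Continuous functional calculus for positive operators\<close>

lemma Weierstrass_poly_sequence:
  fixes f :: "real \<Rightarrow> real"
  assumes "continuous_on {0..L} f"
  obtains p :: "nat \<Rightarrow> real poly" where "uniform_limit {0..L} (\<lambda>n. poly (p n)) f sequentially"
proof -
  have "\<exists>p. \<forall>t\<in>{0..L}. \<bar>f t - poly p t\<bar> < 1 / real (Suc n)" for n
  proof -
    obtain g where g: "real_polynomial_function g" "\<And>t. t \<in> {0..L} \<Longrightarrow> \<bar>f t - g t\<bar> < 1 / real (Suc n)"
      using Stone_Weierstrass_real_polynomial_function[OF compact_Icc assms, of "1 / real (Suc n)"]
      by auto
    then obtain a m where "g = (\<lambda>x. \<Sum>i\<le>m. a i * x ^ i)"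
      using real_polynomial_function_iff_sum by blast
    then have "g t = poly (\<Sum>i\<le>m. monom (a i) i) t" for t
      by (simp add: poly_sum poly_monom)
    with g(2) show ?thesis by metis
  qed
  then obtain p where p: "\<And>n t. t \<in> {0..L} \<Longrightarrow> \<bar>f t - poly (p n) t\<bar> < 1 / real (Suc n)"
    by metis
  have "uniform_limit {0..L} (\<lambda>n. poly (p n)) f sequentially"
  proof (rule uniform_limitI)
    fix e :: real assume "e > 0"
    then have "\<forall>\<^sub>F n in sequentially. 1 / real (Suc n) < e"
      by (rule order_tendstoD[OF LIMSEQ_Suc[OF lim_const_over_n]])
    then show "\<forall>\<^sub>F n in sequentially. \<forall>t\<in>{0..L}. dist (poly (p n) t) (f t) < e"
    proof eventually_elim
      case (elim n)
      then show ?case using p by (fastforce simp: dist_real_def abs_minus_commute intro: order.strict_trans)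
    qed
  qed
  then show ?thesis by (rule that)
qed

text \<open>
  Two polynomials that are uniformly close on the spectrum have close values at \<open>S\<close>, by the norm
  bound. Hence the values along one approximating sequence are Cauchy, every other approximating
  sequence has the same limit, and the definite description denotes this limit.
\<close>

lemma op_cfc_tendsto:
  fixes S :: "'a::chilbert_space \<Rightarrow>\<^sub>L 'a"
  assumes S: "positive_op S" and f: "continuous_on {0..} f"
    and p: "uniform_limit (real_spectrum S) (\<lambda>n. poly (p n)) f sequentially"
  shows "(\<lambda>n. op_poly (p n) S) \<longlonglongrightarrow> op_cfc f S"
proof -
  note sa = positive_op_selfadjoint[OF S]
  have close: "\<exists>N. \<forall>m\<ge>N. \<forall>n\<ge>N. norm (op_poly (a m) S - op_poly (b n) S) < e"
    if a: "uniform_limit (real_spectrum S) (\<lambda>n. poly (a n)) f sequentially"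
      and b: "uniform_limit (real_spectrum S) (\<lambda>n. poly (b n)) f sequentially"
      and "e > 0" for a b :: "nat \<Rightarrow> real poly" and e :: real
  proof -
    have "e / 3 > 0" using \<open>e > 0\<close> by simp
    then obtain N M where
      N: "\<And>n t. n \<ge> N \<Longrightarrow> t \<in> real_spectrum S \<Longrightarrow> dist (poly (a n) t) (f t) < e / 3" and
      M: "\<And>n t. n \<ge> M \<Longrightarrow> t \<in> real_spectrum S \<Longrightarrow> dist (poly (b n) t) (f t) < e / 3"
      using uniform_limitD[OF a] uniform_limitD[OF b] unfolding eventually_sequentially by meson
    have "norm (op_poly (a m) S - op_poly (b n) S) < e" if "m \<ge> max N M" "n \<ge> max N M" for m n
    proof -
      have "norm (op_poly (a m - b n) S) \<le> 2 * e / 3"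
      proof (rule norm_op_poly_le[OF sa])
        fix t assume "t \<in> real_spectrum S"
        then have "dist (poly (a m) t) (f t) < e / 3" "dist (poly (b n) t) (f t) < e / 3"
          using N M that by auto
        then show "\<bar>poly (a m - b n) t\<bar> \<le> 2 * e / 3"
          unfolding dist_real_def poly_diff by linarith
      qed (use \<open>e > 0\<close> in simp)
      also have "\<dots> < e" using \<open>e > 0\<close> by simp
      finally show ?thesis by (simp add: op_poly_diff)
    qed
    then show ?thesis by blast
  qed
  obtain q where q: "uniform_limit {0..norm S} (\<lambda>n. poly (q n)) f sequentially"
    using Weierstrass_poly_sequence continuous_on_subset[OF f] by (metis Icc_subset_Ici_iff order_refl)
  then have q: "uniform_limit (real_spectrum S) (\<lambda>n. poly (q n)) f sequentially"
    using positive_real_spectrum[OF S] by (rule uniform_limit_on_subset)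
  have "Cauchy (\<lambda>n. op_poly (q n) S)"
    unfolding Cauchy_def dist_norm using close[OF q q] by blast
  then obtain R where R: "(\<lambda>n. op_poly (q n) S) \<longlonglongrightarrow> R"
    using Cauchy_convergent convergent_def by blast
  have lim: "(\<lambda>n. op_poly (a n) S) \<longlonglongrightarrow> R"
    if "uniform_limit (real_spectrum S) (\<lambda>n. poly (a n)) f sequentially" for a
  proof -
    have "(\<lambda>n. op_poly (a n) S - op_poly (q n) S) \<longlonglongrightarrow> 0"
      unfolding LIMSEQ_iff using close[OF that q] by (metis diff_zero)
    from tendsto_add[OF this R] show ?thesis by simp
  qed
  have "op_cfc f S = R"
    unfolding op_cfc_def real_spectrum_def[symmetric]
  proof (rule the_equality)
    fix R' assume "\<forall>p. uniform_limit (real_spectrum S) (\<lambda>n. poly (p n)) f sequentially \<longrightarrow>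
      (\<lambda>n. op_poly (p n) S) \<longlonglongrightarrow> R'"
    then show "R' = R" using q R LIMSEQ_unique by blast
  qed (use lim in blast)
  then show ?thesis using lim[OF p] by simp
qed

text \<open>
  For the algebraic rules it is convenient to approximate on an interval around the spectrum: there
  \<open>f\<close> is bounded, and the interval can be enlarged to serve two operators at once.
\<close>

lemma op_cfc_approx:
  assumes S: "positive_op S" and f: "continuous_on {0..} f" and L: "norm S \<le> L"
  obtains p where "uniform_limit {0..L} (\<lambda>n. poly (p n)) f sequentially"
    "(\<lambda>n. op_poly (p n) S) \<longlonglongrightarrow> op_cfc f S"
proof -
  obtain p where p: "uniform_limit {0..L} (\<lambda>n. poly (p n)) f sequentially"
    using Weierstrass_poly_sequence continuous_on_subset[OF f] by (metis Icc_subset_Ici_iff order_refl)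
  moreover have "real_spectrum S \<subseteq> {0..L}"
    using positive_real_spectrum[OF S] L by fastforce
  ultimately show ?thesis
    using that op_cfc_tendsto[OF S f] uniform_limit_on_subset by blast
qed

lemma op_cfc_cong:
  assumes "positive_op S" and "\<And>t. 0 \<le> t \<Longrightarrow> f t = g t"
  shows "op_cfc f S = op_cfc g S"
proof -
  have "uniform_limit (real_spectrum S) h f sequentially \<longleftrightarrow>
      uniform_limit (real_spectrum S) h g sequentially" for h
    using positive_real_spectrum[OF assms(1)] assms(2) by (intro uniform_limit_cong') auto
  then show ?thesis by (simp add: op_cfc_def flip: real_spectrum_def)
qed

lemma op_cfc_poly:
  assumes "positive_op S"
  shows "op_cfc (\<lambda>t. poly p t) S = op_poly p S"
proof -
  have "(\<lambda>n::nat. op_poly p S) \<longlonglongrightarrow> op_cfc (poly p) S"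
    using op_cfc_tendsto[OF assms, of "poly p" "\<lambda>_. p"]
    by (simp add: uniform_limit_const continuous_on_poly)
  then show ?thesis by (simp add: LIMSEQ_const_iff)
qed

lemma op_cfc_const: "positive_op S \<Longrightarrow> op_cfc (\<lambda>_. c) S = c *\<^sub>R id_blinfun"
  using op_cfc_poly[of S "[:c:]"] by (simp add: fun_eq_iff)

lemma op_cfc_ident: "positive_op S \<Longrightarrow> op_cfc (\<lambda>t. t) S = S"
  using op_cfc_poly[of S "[:0, 1:]"] by (auto intro!: blinfun_eqI)

lemma op_cfc_add:
  assumes S: "positive_op S" and f: "continuous_on {0..} f" and g: "continuous_on {0..} g"
  shows "op_cfc (\<lambda>t. f t + g t) S = op_cfc f S + op_cfc g S"
proof -
  obtain p where p: "uniform_limit {0..norm S} (\<lambda>n. poly (p n)) f sequentially"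
    "(\<lambda>n. op_poly (p n) S) \<longlonglongrightarrow> op_cfc f S" using op_cfc_approx[OF S f] by blast
  obtain q where q: "uniform_limit {0..norm S} (\<lambda>n. poly (q n)) g sequentially"
    "(\<lambda>n. op_poly (q n) S) \<longlonglongrightarrow> op_cfc g S" using op_cfc_approx[OF S g] by blast
  have "uniform_limit {0..norm S} (\<lambda>n. poly (p n + q n)) (\<lambda>t. f t + g t) sequentially"
    using uniform_limit_add[OF p(1) q(1)] by (simp add: poly_add[abs_def])
  then have "(\<lambda>n. op_poly (p n + q n) S) \<longlonglongrightarrow> op_cfc (\<lambda>t. f t + g t) S"
    using uniform_limit_on_subset positive_real_spectrum[OF S] f g
    by (intro op_cfc_tendsto[OF S] continuous_intros) blast+
  moreover have "(\<lambda>n. op_poly (p n + q n) S) \<longlonglongrightarrow> op_cfc f S + op_cfc g S"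
    unfolding op_poly_add by (intro tendsto_add p q)
  ultimately show ?thesis by (rule LIMSEQ_unique)
qed

lemma op_cfc_mult:
  assumes S: "positive_op S" and f: "continuous_on {0..} f" and g: "continuous_on {0..} g"
  shows "op_cfc (\<lambda>t. f t * g t) S = op_cfc f S o\<^sub>L op_cfc g S"
proof -
  obtain p where p: "uniform_limit {0..norm S} (\<lambda>n. poly (p n)) f sequentially"
    "(\<lambda>n. op_poly (p n) S) \<longlonglongrightarrow> op_cfc f S" using op_cfc_approx[OF S f] by blast
  obtain q where q: "uniform_limit {0..norm S} (\<lambda>n. poly (q n)) g sequentially"
    "(\<lambda>n. op_poly (q n) S) \<longlonglongrightarrow> op_cfc g S" using op_cfc_approx[OF S g] by blast
  have bdd: "bounded (h ` {0..norm S})" if "continuous_on {0..} h" for h :: "real \<Rightarrow> real"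
    by (intro compact_imp_bounded compact_continuous_image compact_Icc continuous_on_subset[OF that]) auto
  have "uniform_limit {0..norm S} (\<lambda>n. poly (p n * q n)) (\<lambda>t. f t * g t) sequentially"
    using uniform_lim_mult[OF p(1) q(1) bdd[OF f] bdd[OF g]] by (simp add: poly_mult[abs_def])
  then have "(\<lambda>n. op_poly (p n * q n) S) \<longlonglongrightarrow> op_cfc (\<lambda>t. f t * g t) S"
    using uniform_limit_on_subset positive_real_spectrum[OF S] f g
    by (intro op_cfc_tendsto[OF S] continuous_intros) blast+
  moreover have "(\<lambda>n. op_poly (p n * q n) S) \<longlonglongrightarrow> (op_cfc f S o\<^sub>L op_cfc g S)"
    unfolding op_poly_mult
    by (intro bounded_bilinear.tendsto[OF bounded_bilinear_blinfun_compose] p q)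
  ultimately show ?thesis by (rule LIMSEQ_unique)
qed

lemma op_cfc_selfadjoint:
  assumes S: "positive_op S" and f: "continuous_on {0..} f"
  shows "selfadjoint_op (op_cfc f S)"
proof -
  obtain p where p: "(\<lambda>n. op_poly (p n) S) \<longlonglongrightarrow> op_cfc f S" using op_cfc_approx[OF S f] by blast
  have "cinner (op_cfc f S x) y = cinner x (op_cfc f S y)" for x y
  proof (rule LIMSEQ_unique)
    show "(\<lambda>n. cinner (op_poly (p n) S x) y) \<longlonglongrightarrow> cinner (op_cfc f S x) y"
      by (intro cinner.tendsto blinfun.tendsto p tendsto_const)
    have "(\<lambda>n. cinner x (op_poly (p n) S y)) \<longlonglongrightarrow> cinner x (op_cfc f S y)"
      by (intro cinner.tendsto blinfun.tendsto p tendsto_const)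
    then show "(\<lambda>n. cinner (op_poly (p n) S x) y) \<longlonglongrightarrow> cinner x (op_cfc f S y)"
      using op_poly_selfadjoint[OF positive_op_selfadjoint[OF S]] by (simp add: selfadjoint_opD)
  qed
  then show ?thesis by (simp add: selfadjoint_op_def)
qed

text \<open>This contains the rule \<open>A\<^sup>* f(AA\<^sup>*) = f(A\<^sup>*A) A\<^sup>*\<close>, which takes the place of the polar decomposition of \<open>A\<close>.\<close>

lemma op_cfc_intertwine:
  fixes S :: "'a::chilbert_space \<Rightarrow>\<^sub>L 'a" and T :: "'b::chilbert_space \<Rightarrow>\<^sub>L 'b" and A :: "'a \<Rightarrow>\<^sub>L 'b"
  assumes S: "positive_op S" and T: "positive_op T" and f: "continuous_on {0..} f"
    and A: "\<And>x. A (S x) = T (A x)"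
  shows "A (op_cfc f S x) = op_cfc f T (A x)"
proof -
  obtain p where p: "uniform_limit {0..max (norm S) (norm T)} (\<lambda>n. poly (p n)) f sequentially"
    "(\<lambda>n. op_poly (p n) S) \<longlonglongrightarrow> op_cfc f S"
    using op_cfc_approx[OF S f, of "max (norm S) (norm T)"] by auto
  have "real_spectrum T \<subseteq> {0..max (norm S) (norm T)}"
    using positive_real_spectrum[OF T] by fastforce
  then have q: "(\<lambda>n. op_poly (p n) T) \<longlonglongrightarrow> op_cfc f T"
    using op_cfc_tendsto[OF T f] uniform_limit_on_subset p(1) by blast
  show ?thesis
  proof (rule LIMSEQ_unique)
    show "(\<lambda>n. A (op_poly (p n) S x)) \<longlonglongrightarrow> A (op_cfc f S x)"
      by (intro blinfun.tendsto p tendsto_const)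
    show "(\<lambda>n. A (op_poly (p n) S x)) \<longlonglongrightarrow> op_cfc f T (A x)"
      unfolding op_poly_intertwine[of A S T, OF A] by (intro blinfun.tendsto q tendsto_const)
  qed
qed

lemma norm_op_cfc_le:
  assumes S: "positive_op S" and f: "continuous_on {0..} f"
    and e: "\<And>t. t \<in> {0..norm S} \<Longrightarrow> \<bar>f t\<bar> \<le> e"
  shows "norm (op_cfc f S) \<le> e"
proof (rule field_le_epsilon)
  fix d :: real assume "d > 0"
  obtain p where p: "uniform_limit {0..norm S} (\<lambda>n. poly (p n)) f sequentially"
    "(\<lambda>n. op_poly (p n) S) \<longlonglongrightarrow> op_cfc f S" using op_cfc_approx[OF S f] by blast
  have "0 \<le> e" using e[of 0] by force
  have "\<forall>\<^sub>F n in sequentially. norm (op_poly (p n) S) \<le> e + d"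
    using uniform_limitD[OF p(1) \<open>d > 0\<close>]
  proof eventually_elim
    case (elim n)
    show ?case
    proof (rule norm_op_poly_le[OF positive_op_selfadjoint[OF S]])
      fix t assume "t \<in> real_spectrum S"
      then have "t \<in> {0..norm S}" using positive_real_spectrum[OF S] by blast
      then show "\<bar>poly (p n) t\<bar> \<le> e + d" using elim e by (force simp: dist_real_def)
    qed (use \<open>0 \<le> e\<close> \<open>d > 0\<close> in simp)
  qed
  then show "norm (op_cfc f S) \<le> e + d"
    by (rule tendsto_upperbound[OF tendsto_norm[OF p(2)]]) simp
qed

text \<open>A nonnegative function is a square, and the square of a self-adjoint operator is positive.\<close>

lemma op_cfc_positive:
  assumes S: "positive_op S" and f: "continuous_on {0..} f" and "\<And>t. 0 \<le> t \<Longrightarrow> 0 \<le> f t"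
  shows "positive_op (op_cfc f S)"
proof -
  let ?R = "op_cfc (\<lambda>t. sqrt (f t)) S"
  have c: "continuous_on {0..} (\<lambda>t. sqrt (f t))" using f by (intro continuous_intros)
  have "op_cfc f S = op_cfc (\<lambda>t. sqrt (f t) * sqrt (f t)) S"
    using assms(3) by (intro op_cfc_cong[OF S]) simp
  also have "\<dots> = ?R o\<^sub>L ?R" by (rule op_cfc_mult[OF S c c])
  finally have "Re (cinner (op_cfc f S x) x) = (norm (?R x))\<^sup>2" for x
    using Re_cinner_selfadjoint_twice[OF op_cfc_selfadjoint[OF S c]] by simp
  then show ?thesis
    using op_cfc_selfadjoint[OF S f] by (simp add: positive_op_def)
qed

lemma op_cfc_mono:
  assumes S: "positive_op S" and f: "continuous_on {0..} f" and g: "continuous_on {0..} g"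
    and le: "\<And>t. 0 \<le> t \<Longrightarrow> f t \<le> g t"
  shows "Re (cinner (op_cfc f S x) x) \<le> Re (cinner (op_cfc g S x) x)"
proof -
  have c: "continuous_on {0..} (\<lambda>t. g t - f t)" using f g by (intro continuous_intros)
  have "op_cfc g S = op_cfc (\<lambda>t. f t + (g t - f t)) S" by simp
  also have "\<dots> = op_cfc f S + op_cfc (\<lambda>t. g t - f t) S" by (rule op_cfc_add[OF S f c])
  finally show ?thesis
    using positive_op_nonneg[OF op_cfc_positive[OF S c], of x] le
    by (simp add: blinfun.add_left cinner.add_left)
qed

text \<open>
  For a polynomial \<open>f\<close> the composition rule is multiplicativity; both sides depend continuously
  on \<open>f\<close> in the supremum norm of an interval that contains the spectrum of \<open>g(S)\<close> and the values
  of \<open>g\<close> on the spectrum of \<open>S\<close>.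
\<close>

lemma op_cfc_compose:
  assumes S: "positive_op S" and f: "continuous_on {0..} f" and g: "continuous_on {0..} g"
    and nonneg: "\<And>t. 0 \<le> t \<Longrightarrow> 0 \<le> g t"
  shows "op_cfc f (op_cfc g S) = op_cfc (\<lambda>t. f (g t)) S"
proof -
  let ?G = "op_cfc g S"
  have G: "positive_op ?G" by (rule op_cfc_positive[OF S g nonneg])
  have fg: "continuous_on {0..} (\<lambda>t. h (g t))" if "continuous_on {0..} h" for h :: "real \<Rightarrow> real"
    by (rule continuous_on_compose2[OF that g]) (use nonneg in auto)
  have poly: "op_poly p ?G = op_cfc (\<lambda>t. poly p (g t)) S" for p
  proof (induction p)
    case 0
    then show ?case using op_cfc_const[OF S, of 0] by simp
  next
    case (pCons a p)
    have c: "continuous_on {0..} (\<lambda>t. poly p (g t))" by (intro fg continuous_intros)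
    have "op_cfc (\<lambda>t. a + g t * poly p (g t)) S = op_cfc (\<lambda>_. a) S + (?G o\<^sub>L op_cfc (\<lambda>t. poly p (g t)) S)"
      using op_cfc_add[OF S, of "\<lambda>_. a" "\<lambda>t. g t * poly p (g t)"] op_cfc_mult[OF S g c] c g
      by (simp add: continuous_on_mult)
    then show ?case by (simp add: pCons op_cfc_const[OF S])
  qed
  have "compact (g ` {0..norm S})"
    by (intro compact_continuous_image compact_Icc continuous_on_subset[OF g]) auto
  then obtain K where K: "\<And>t. t \<in> {0..norm S} \<Longrightarrow> \<bar>g t\<bar> \<le> K"
    using compact_imp_bounded bounded_iff by (metis image_eqI real_norm_def)
  define L where "L = max (norm ?G) K"
  obtain q where q: "uniform_limit {0..L} (\<lambda>n. poly (q n)) f sequentially"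
    "(\<lambda>n. op_poly (q n) ?G) \<longlonglongrightarrow> op_cfc f ?G"
    using op_cfc_approx[OF G f, of L] by (auto simp: L_def)
  have "(\<lambda>n. op_poly (q n) ?G) \<longlonglongrightarrow> op_cfc (\<lambda>t. f (g t)) S"
  proof (rule LIMSEQ_I)
    fix e :: real assume "e > 0"
    then have "\<forall>\<^sub>F n in sequentially. \<forall>t\<in>{0..L}. dist (poly (q n) t) (f t) < e / 2"
      using uniform_limitD[OF q(1)] half_gt_zero by blast
    then have "\<forall>\<^sub>F n in sequentially. norm (op_poly (q n) ?G - op_cfc (\<lambda>t. f (g t)) S) < e"
    proof eventually_elim
      case (elim n)
      have c: "continuous_on {0..} (\<lambda>t. poly (q n) t - f t)" using f by (intro continuous_intros)
      have "op_poly (q n) ?G = op_cfc (\<lambda>t. (poly (q n) (g t) - f (g t)) + f (g t)) S"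
        by (simp add: poly)
      also have "\<dots> = op_cfc (\<lambda>t. poly (q n) (g t) - f (g t)) S + op_cfc (\<lambda>t. f (g t)) S"
        by (rule op_cfc_add[OF S fg[OF c] fg[OF f]])
      finally have "norm (op_poly (q n) ?G - op_cfc (\<lambda>t. f (g t)) S)
          = norm (op_cfc (\<lambda>t. poly (q n) (g t) - f (g t)) S)" by simp
      also have "\<dots> \<le> e / 2"
      proof (rule norm_op_cfc_le[OF S fg[OF c]])
        fix t assume "t \<in> {0..norm S}"
        then have "g t \<in> {0..L}" using K[of t] nonneg[of t] by (auto simp: L_def)
        then show "\<bar>poly (q n) (g t) - f (g t)\<bar> \<le> e / 2"
          using elim by (force simp: dist_real_def)
      qed
      finally show ?case using \<open>e > 0\<close> by simp
    qed
    then show "\<exists>N. \<forall>n\<ge>N. norm (op_poly (q n) ?G - op_cfc (\<lambda>t. f (g t)) S) < e"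
      by (simp add: eventually_sequentially)
  qed
  with q(2) show ?thesis by (rule LIMSEQ_unique)
qed


section \<open>Powers of positive operators\<close>

text \<open>
  The real power with the convention \<open>0\<^sup>0 = 1\<close>. With it, the rules for exponents hold down to the
  exponent 0, and each power with nonnegative exponent is continuous on the half line.
\<close>

definition cpowr :: "real \<Rightarrow> real \<Rightarrow> real"
  where "cpowr a t = (if a = 0 then 1 else t powr a)"

lemma op_powr_cpowr: "op_powr S a = op_cfc (cpowr a) S"
  by (simp add: op_powr_def cpowr_def[abs_def])

lemma cpowr_nonneg [simp]: "0 \<le> cpowr a t"
  by (simp add: cpowr_def)

lemma continuous_on_cpowr: "0 \<le> a \<Longrightarrow> continuous_on {0..} (cpowr a)"
  unfolding cpowr_def[abs_def]
  by (cases "a = 0") (auto intro!: continuous_on_powr' continuous_on_id continuous_on_const)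

lemma cpowr_add: "0 \<le> a \<Longrightarrow> 0 \<le> b \<Longrightarrow> cpowr (a + b) t = cpowr a t * cpowr b t"
  by (simp add: cpowr_def powr_add)

lemma cpowr_cpowr: "cpowr b (cpowr a t) = cpowr (a * b) t"
  by (simp add: cpowr_def powr_powr)

lemma cpowr_1: "0 \<le> t \<Longrightarrow> cpowr 1 t = t"
  by (simp add: cpowr_def)

lemma op_powr_positive: "positive_op S \<Longrightarrow> 0 \<le> a \<Longrightarrow> positive_op (op_powr S a)"
  unfolding op_powr_cpowr by (intro op_cfc_positive continuous_on_cpowr) auto

lemma op_powr_twice:
  assumes "positive_op S" "0 \<le> a"
  shows "op_powr S a o\<^sub>L op_powr S a = op_powr S (2 * a)"
proof -
  have "cpowr (2 * a) = (\<lambda>t. cpowr a t * cpowr a t)"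
    using cpowr_add[OF assms(2,2)] by (simp add: fun_eq_iff)
  then show ?thesis
    using op_cfc_mult[OF assms(1) continuous_on_cpowr continuous_on_cpowr] assms(2)
    by (simp add: op_powr_cpowr)
qed

lemma op_powr_powr:
  assumes "positive_op S" "0 \<le> a" "0 \<le> b"
  shows "op_powr (op_powr S a) b = op_powr S (a * b)"
  using op_cfc_compose[OF assms(1) continuous_on_cpowr[OF assms(3)] continuous_on_cpowr[OF assms(2)]]
  by (simp add: op_powr_cpowr cpowr_cpowr)

lemma positive_op_abs: "clinear_op S \<Longrightarrow> positive_op (op_abs S)"
  unfolding op_abs_def by (intro op_powr_positive positive_cadjoint_compose) auto

lemma op_abs_powr: "clinear_op S \<Longrightarrow> 0 \<le> a \<Longrightarrow> op_powr (op_abs S) (2 * a) = op_powr (cadjoint S o\<^sub>L S) a"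
  unfolding op_abs_def by (subst op_powr_powr) (auto intro: positive_cadjoint_compose)

section \<open>The mixed Schwarz inequality\<close>

text \<open>
  With \<open>P = A\<^sup>*A\<close>, \<open>Q = AA\<^sup>*\<close> and a function \<open>g > 0\<close>, the intertwining \<open>A\<^sup>* f(Q) = f(P) A\<^sup>*\<close> gives
  \<open>\<langle>Ax,y\<rangle> = \<langle>g\<^sup>1\<^sup>/\<^sup>2(P) x, A\<^sup>* g\<^sup>-\<^sup>1\<^sup>/\<^sup>2(Q) y\<rangle>\<close>, so that Cauchy-Schwarz bounds its square by
  \<open>\<langle>g(P)x,x\<rangle> \<langle>h(Q)y,y\<rangle>\<close> with \<open>h(t) = t / g(t)\<close>. The choice \<open>g(t) = t\<^sup>\<theta> + \<delta>\<close> makes \<open>h(t) \<le> t\<^sup>1\<^sup>-\<^sup>\<theta>\<close>,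
  and \<open>\<delta> \<rightarrow> 0\<close> removes the perturbation.
\<close>

lemma mixed_Schwarz_perturbed:
  fixes A :: "'a::chilbert_space \<Rightarrow>\<^sub>L 'b::chilbert_space"
  assumes A: "clinear_op A" and \<theta>: "0 \<le> \<theta>" "\<theta> \<le> 1" and "\<delta> > 0"
  shows "(cmod (cinner (A x) y))\<^sup>2 \<le>
    (Re (cinner (op_powr (cadjoint A o\<^sub>L A) \<theta> x) x) + \<delta> * (norm x)\<^sup>2) *
    Re (cinner (op_powr (A o\<^sub>L cadjoint A) (1 - \<theta>) y) y)"
proof -
  let ?P = "cadjoint A o\<^sub>L A" and ?Q = "A o\<^sub>L cadjoint A"
  have P: "positive_op ?P" by (rule positive_cadjoint_compose[OF A])
  have Q: "positive_op ?Q"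
    using positive_cadjoint_compose[OF clinear_cadjoint[OF A]] by (simp add: cadjoint_cadjoint[OF A])
  define g where "g t = cpowr \<theta> t + \<delta>" for t
  have g_pos: "g t > 0" for t using \<open>\<delta> > 0\<close> by (simp add: g_def add_nonneg_pos)
  have g: "continuous_on {0..} g"
    unfolding g_def by (intro continuous_intros continuous_on_cpowr \<theta>)
  define s where "s t = sqrt (g t)" for t
  define i where "i t = 1 / sqrt (g t)" for t
  have s: "continuous_on {0..} s" unfolding s_def by (intro continuous_intros g)
  have i: "continuous_on {0..} i"
    unfolding i_def using g_pos by (intro continuous_intros g) (auto simp: less_imp_neq[symmetric])
  have "op_cfc i ?P o\<^sub>L op_cfc s ?P = op_cfc (\<lambda>_. 1) ?P"
    unfolding op_cfc_mult[OF P i s, symmetric]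
    using g_pos by (intro op_cfc_cong[OF P]) (simp add: i_def s_def less_imp_neq[symmetric])
  then have inv: "op_cfc i ?P (op_cfc s ?P x) = x"
    using op_cfc_const[OF P, of 1] by (metis blinfun_apply_blinfun_compose blinfun_apply_id_blinfun scaleR_one)
  have "cinner (A x) y = cinner (op_cfc i ?P (op_cfc s ?P x)) (cadjoint A y)"
    by (simp add: inv cinner_cadjoint[OF A])
  also have "\<dots> = cinner (op_cfc s ?P x) (op_cfc i ?P (cadjoint A y))"
    by (rule selfadjoint_opD[OF op_cfc_selfadjoint[OF P i]])
  also have "op_cfc i ?P (cadjoint A y) = cadjoint A (op_cfc i ?Q y)"
    by (rule op_cfc_intertwine[OF Q P i, symmetric]) simp
  finally have "(cmod (cinner (A x) y))\<^sup>2 \<le> (norm (op_cfc s ?P x))\<^sup>2 * (norm (cadjoint A (op_cfc i ?Q y)))\<^sup>2"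
    using cinner_Cauchy_Schwarz[of "op_cfc s ?P x" "cadjoint A (op_cfc i ?Q y)"]
    by (metis norm_ge_zero power_mono power_mult_distrib)
  also have "(norm (op_cfc s ?P x))\<^sup>2 = Re (cinner (op_powr ?P \<theta> x) x) + \<delta> * (norm x)\<^sup>2"
  proof -
    have "op_cfc s ?P o\<^sub>L op_cfc s ?P = op_cfc g ?P"
      unfolding op_cfc_mult[OF P s s, symmetric]
      using g_pos by (intro op_cfc_cong[OF P]) (simp add: s_def less_imp_le)
    then have "(norm (op_cfc s ?P x))\<^sup>2 = Re (cinner (op_cfc g ?P x) x)"
      using Re_cinner_selfadjoint_twice[OF op_cfc_selfadjoint[OF P s], of x]
      by (metis blinfun_apply_blinfun_compose)
    also have "op_cfc g ?P = op_powr ?P \<theta> + \<delta> *\<^sub>R id_blinfun"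
      unfolding g_def[abs_def] op_powr_cpowr op_cfc_const[OF P, symmetric]
      by (intro op_cfc_add P continuous_on_cpowr \<theta> continuous_intros)
    finally show ?thesis
      by (simp add: blinfun.bilinear_simps cinner.add_left cinner_scaleR_left)
  qed
  also have "(norm (cadjoint A (op_cfc i ?Q y)))\<^sup>2 \<le> Re (cinner (op_powr ?Q (1 - \<theta>) y) y)"
  proof -
    have ti: "continuous_on {0..} (\<lambda>t. t * i t)" by (intro continuous_intros i)
    have iti: "continuous_on {0..} (\<lambda>t. i t * (t * i t))" by (intro continuous_on_mult i ti)
    have "(norm (cadjoint A (op_cfc i ?Q y)))\<^sup>2 = Re (cinner (?Q (op_cfc i ?Q y)) (op_cfc i ?Q y))"
      by (simp add: cinner_cadjoint[OF A])
    also have "\<dots> = Re (cinner (op_cfc i ?Q (?Q (op_cfc i ?Q y))) y)"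
      using selfadjoint_opD[OF op_cfc_selfadjoint[OF Q i]] by simp
    also have "op_cfc i ?Q (?Q (op_cfc i ?Q y)) = op_cfc (\<lambda>t. i t * (t * i t)) ?Q y"
      using op_cfc_mult[OF Q i ti] op_cfc_mult[OF Q continuous_on_id i]
      by (simp add: op_cfc_ident[OF Q])
    also have "Re (cinner (op_cfc (\<lambda>t. i t * (t * i t)) ?Q y) y) \<le> Re (cinner (op_powr ?Q (1 - \<theta>) y) y)"
      unfolding op_powr_cpowr
    proof (rule op_cfc_mono[OF Q iti])
      show "continuous_on {0..} (cpowr (1 - \<theta>))" using \<theta> by (intro continuous_on_cpowr) simp
      fix t :: real assume t: "0 \<le> t"
      have "t = cpowr \<theta> t * cpowr (1 - \<theta>) t"
        using cpowr_add[of \<theta> "1 - \<theta>" t] \<theta> t by (simp add: cpowr_1)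
      also have "\<dots> \<le> g t * cpowr (1 - \<theta>) t"
        using \<open>\<delta> > 0\<close> by (intro mult_right_mono) (auto simp: g_def)
      finally have "t / g t \<le> cpowr (1 - \<theta>) t"
        using g_pos[of t] by (simp add: field_simps)
      moreover have "i t * (t * i t) = t / g t"
        using g_pos[of t] by (simp add: i_def field_simps)
      ultimately show "i t * (t * i t) \<le> cpowr (1 - \<theta>) t" by simp
    qed
    finally show ?thesis .
  qed
  finally show ?thesis
    by (simp add: mult_left_mono add_nonneg_nonneg positive_op_nonneg[OF op_powr_positive[OF P \<theta>(1)]] less_imp_le[OF \<open>\<delta> > 0\<close>])
qed

lemma mixed_Schwarz:
  fixes A :: "'a::chilbert_space \<Rightarrow>\<^sub>L 'a"
  assumes A: "clinear_op A" and \<theta>: "0 \<le> \<theta>" "\<theta> \<le> 1"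
  shows "(cmod (cinner (A x) y))\<^sup>2 \<le>
    Re (cinner (op_powr (op_abs A) (2 * \<theta>) x) x) *
    Re (cinner (op_powr (op_abs (cadjoint A)) (2 * (1 - \<theta>)) y) y)"
proof -
  define X where "X = Re (cinner (op_powr (cadjoint A o\<^sub>L A) \<theta> x) x)"
  define Y where "Y = Re (cinner (op_powr (A o\<^sub>L cadjoint A) (1 - \<theta>) y) y)"
  have XY: "Re (cinner (op_powr (op_abs A) (2 * \<theta>) x) x) = X"
    "Re (cinner (op_powr (op_abs (cadjoint A)) (2 * (1 - \<theta>)) y) y) = Y"
    using op_abs_powr[OF A \<theta>(1)] op_abs_powr[OF clinear_cadjoint[OF A], of "1 - \<theta>"] \<theta>(2)
    by (simp_all add: X_def Y_def cadjoint_cadjoint[OF A])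
  have Y: "Y \<ge> 0"
    unfolding XY(2)[symmetric] using \<theta>
    by (intro positive_op_nonneg op_powr_positive positive_op_abs clinear_cadjoint A) simp
  have "(cmod (cinner (A x) y))\<^sup>2 \<le> X * Y"
  proof (rule field_le_epsilon)
    fix e :: real assume "e > 0"
    \<comment> \<open>The perturbation \<open>\<delta> = e / c\<close> costs at most \<open>e\<close>.\<close>
    define c where "c = (norm x)\<^sup>2 * Y + 1"
    have c: "c > 0" using Y by (simp add: c_def add_nonneg_pos)
    have "(cmod (cinner (A x) y))\<^sup>2 \<le> (X + e / c * (norm x)\<^sup>2) * Y"
      unfolding X_def Y_def using \<open>e > 0\<close> c by (intro mixed_Schwarz_perturbed A \<theta>) simp
    also have "\<dots> = X * Y + e * ((norm x)\<^sup>2 * Y / c)" by (simp add: algebra_simps)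
    also have "\<dots> \<le> X * Y + e * 1"
      using \<open>e > 0\<close> c by (intro add_left_mono mult_left_mono) (auto simp: c_def)
    finally show "(cmod (cinner (A x) y))\<^sup>2 \<le> X * Y + e" by simp
  qed
  then show ?thesis by (simp only: XY)
qed

section \<open>A power-mean inequality for quadratic forms\<close>

text \<open>
  The graph of the convex function \<open>y \<mapsto> y\<^sup>r\<close> lies above its tangent at \<open>s\<close>; this is Young's inequality
  for \<open>y\<close> and \<open>s\<^bsup>r-1\<^esup>\<close>.
\<close>

lemma powr_tangent_le:
  fixes y s r :: real
  assumes "0 \<le> y" "0 < s" "1 \<le> r"
  shows "r * s powr (r - 1) * y - (r - 1) * s powr r \<le> y powr r"
proof (cases "y = 0")
  case True
  then show ?thesis using assms by simp
next
  case False
  have "(y powr r) powr (1 / r) * (s powr r) powr (1 - 1 / r)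
      \<le> 1 / r * y powr r + (1 - 1 / r) * s powr r"
    using False assms by (intro Youngs_inequality_0) auto
  then have "y * s powr (r - 1) \<le> 1 / r * y powr r + (1 - 1 / r) * s powr r"
    using assms by (simp add: powr_powr right_diff_distrib)
  then have "r * (y * s powr (r - 1)) \<le> r * (1 / r * y powr r + (1 - 1 / r) * s powr r)"
    using assms by (intro mult_left_mono) auto
  also have "\<dots> = y powr r + (r - 1) * s powr r" using assms by (simp add: field_simps)
  finally show ?thesis by (simp add: mult_ac)
qed

lemma op_powr_tangent:
  assumes S: "positive_op S" and a: "0 \<le> a" and "1 \<le> r" "0 < s"
  shows "r * s powr (r - 1) * Re (cinner (op_powr S a x) x) - (r - 1) * s powr r * (norm x)\<^sup>2
    \<le> Re (cinner (op_powr S (r * a) x) x)"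
proof -
  let ?c = "r * s powr (r - 1)" and ?d = "- ((r - 1) * s powr r)"
  have c1: "continuous_on {0..} (\<lambda>t. ?c * cpowr a t)"
    by (intro continuous_intros continuous_on_cpowr a)
  have c2: "continuous_on {0..} (\<lambda>t. ?c * cpowr a t + ?d)"
    by (intro continuous_intros continuous_on_cpowr a)
  have "op_cfc (\<lambda>t. ?c * cpowr a t + ?d) S = op_cfc (\<lambda>t. ?c * cpowr a t) S + op_cfc (\<lambda>_. ?d) S"
    by (rule op_cfc_add[OF S c1 continuous_on_const])
  also have "op_cfc (\<lambda>t. ?c * cpowr a t) S = op_cfc (\<lambda>_. ?c) S o\<^sub>L op_cfc (cpowr a) S"
    by (rule op_cfc_mult[OF S continuous_on_const continuous_on_cpowr[OF a]])
  finally have "Re (cinner (op_cfc (\<lambda>t. ?c * cpowr a t + ?d) S x) x)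
      = ?c * Re (cinner (op_powr S a x) x) - (r - 1) * s powr r * (norm x)\<^sup>2"
    by (simp add: op_powr_cpowr op_cfc_const[OF S] blinfun.bilinear_simps cinner.add_left cinner.diff_left
        cinner_scaleR_left cinner.minus_left)
  moreover have "Re (cinner (op_cfc (\<lambda>t. ?c * cpowr a t + ?d) S x) x) \<le> Re (cinner (op_powr S (r * a) x) x)"
    unfolding op_powr_cpowr
  proof (rule op_cfc_mono[OF S c2])
    show "continuous_on {0..} (cpowr (r * a))" using assms by (intro continuous_on_cpowr) simp
    fix t :: real
    have "cpowr (r * a) t = cpowr a t powr r"
      using \<open>1 \<le> r\<close> cpowr_cpowr[of r a t] by (simp add: cpowr_def mult.commute)
    then show "?c * cpowr a t + ?d \<le> cpowr (r * a) t"
      using powr_tangent_le[of "cpowr a t" s r] assms by simp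
  qed
  ultimately show ?thesis by simp
qed

text \<open>
  McCarthy's inequality for the diagonal operator with entries \<open>S\<close> and \<open>T\<close>. As in the proof of Jensen's
  inequality, one uses the tangent of \<open>y \<mapsto> y\<^sup>r\<close> at the mean \<open>s\<close>, which is the value of the quadratic form
  of the power \<open>a\<close> at the unit vector \<open>(x, y)\<close>; both entries must use the same tangent.
\<close>

lemma McCarthy_inequality_pair:
  assumes S: "positive_op S" and T: "positive_op T" and a: "0 \<le> a" and r: "1 \<le> r"
    and unit: "(norm x)\<^sup>2 + (norm y)\<^sup>2 = 1"
  shows "(Re (cinner (op_powr S a x) x) + Re (cinner (op_powr T a y) y)) powr r
    \<le> Re (cinner (op_powr S (r * a) x) x) + Re (cinner (op_powr T (r * a) y) y)"
proof -
  define s where "s = Re (cinner (op_powr S a x) x) + Re (cinner (op_powr T a y) y)"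
  have nS: "0 \<le> Re (cinner (op_powr S b x) x)" and nT: "0 \<le> Re (cinner (op_powr T b y) y)" if "0 \<le> b" for b
    using that S T by (auto intro!: positive_op_nonneg op_powr_positive)
  have ra: "0 \<le> r * a" using a r by simp
  show ?thesis
  proof (cases "s = 0")
    case True
    then show ?thesis using nS[OF ra] nT[OF ra] by (simp add: s_def)
  next
    case False
    then have s: "s > 0" using nS[OF a] nT[OF a] by (simp add: s_def)
    have "s powr r = r * s powr (r - 1) * s - (r - 1) * s powr r * ((norm x)\<^sup>2 + (norm y)\<^sup>2)"
      using s by (simp add: unit powr_diff algebra_simps)
    also have "\<dots> = (r * s powr (r - 1) * Re (cinner (op_powr S a x) x) - (r - 1) * s powr r * (norm x)\<^sup>2)
       + (r * s powr (r - 1) * Re (cinner (op_powr T a y) y) - (r - 1) * s powr r * (norm y)\<^sup>2)"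
    proof -
      have "r * s powr (r - 1) * s = r * s powr (r - 1) * Re (cinner (op_powr S a x) x)
          + r * s powr (r - 1) * Re (cinner (op_powr T a y) y)"
        by (subst (2) s_def) (rule distrib_left)
      then show ?thesis by (simp only: distrib_left)
    qed
    also have "\<dots> \<le> Re (cinner (op_powr S (r * a) x) x) + Re (cinner (op_powr T (r * a) y) y)"
      by (intro add_mono op_powr_tangent S T a r s)
    finally show ?thesis by (simp add: s_def)
  qed
qed

section \<open>The numerical radius of an off-diagonal operator\<close>

lemma bdd_above_numerical_range:
  "bdd_above (insert 0 {cmod (cinner (blinfun_apply S x) x) | x. norm x = 1})"
proof (rule bdd_aboveI)
  fix z assume "z \<in> insert 0 {cmod (cinner (blinfun_apply S x) x) | x. norm x = 1}"
  moreover have "cmod (cinner (S x) x) \<le> norm S" if "norm x = 1" for x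
    using cinner_Cauchy_Schwarz[of "S x" x] norm_blinfun[of S x] that by simp
  ultimately show "z \<le> norm S" by auto
qed

lemma numerical_radius_nonneg: "0 \<le> numerical_radius S"
  unfolding numerical_radius_def by (rule cSup_upper[OF _ bdd_above_numerical_range]) simp

lemma cmod_cinner_le_numerical_radius:
  fixes S :: "'a::complex_inner \<Rightarrow>\<^sub>L 'a"
  shows "cmod (cinner (S x) x) \<le> numerical_radius S * (norm x)\<^sup>2"
proof (cases "x = 0")
  case False
  define u where "u = (1 / norm x) *\<^sub>R x"
  have x: "x = norm x *\<^sub>R u" and u: "norm u = 1" using False by (simp_all add: u_def)
  have "cmod (cinner (S u) u) \<le> numerical_radius S"
    unfolding numerical_radius_def using u
    by (intro cSup_upper[OF _ bdd_above_numerical_range]) auto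
  then have "(norm x)\<^sup>2 * cmod (cinner (S u) u) \<le> (norm x)\<^sup>2 * numerical_radius S"
    by (rule mult_left_mono) simp
  moreover have "cmod (cinner (S x) x) = (norm x)\<^sup>2 * cmod (cinner (S u) u)"
    by (subst (1 2) x)
      (simp add: blinfun.scaleR_right cinner_scaleR_left cinner_scaleR_right norm_mult power2_eq_square)
  ultimately show ?thesis by (simp add: mult.commute)
qed simp

text \<open>The cross term \<open>2 p q\<close> is bounded by the arithmetic-geometric mean inequality.\<close>

lemma Cauchy_Schwarz_two_terms:
  fixes p q x1 x2 y1 y2 :: real
  assumes "p\<^sup>2 \<le> x1 * y1" "q\<^sup>2 \<le> x2 * y2" "0 \<le> x1" "0 \<le> x2" "0 \<le> y1" "0 \<le> y2"
  shows "(p + q)\<^sup>2 \<le> (x1 + x2) * (y1 + y2)"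
proof -
  have "(2 * (p * q))\<^sup>2 = 4 * (p\<^sup>2 * q\<^sup>2)" by (simp add: power_mult_distrib)
  also have "\<dots> \<le> 4 * ((x1 * y1) * (x2 * y2))"
    using assms by (intro mult_left_mono mult_mono) auto
  also have "\<dots> \<le> (x1 * y2 + x2 * y1)\<^sup>2"
    using zero_le_power2[of "x1 * y2 - x2 * y1"] by (simp add: power2_eq_square algebra_simps)
  finally have "2 * (p * q) \<le> x1 * y2 + x2 * y1"
    by (rule power2_le_imp_le) (use assms in simp)
  then show ?thesis using assms(1,2) by (simp add: power2_eq_square algebra_simps)
qed

text \<open>
  Buzano's inequality in \<open>H \<oplus> H\<close>, applied to the images of the unit vector \<open>(u, v)\<close> under the diagonal
  operators \<open>P\<close>, \<open>Q\<close> with entries \<open>P\<^sub>i\<close>, \<open>Q\<^sub>i\<close>. The product of the norms is bounded by half of the form of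
  \<open>P\<^sup>2 + Q\<^sup>2\<close>, and the inner product of the images is a value of the form of \<open>PQ\<close> up to conjugation.
  A convex combination with weights \<open>\<parallel>u\<parallel>\<^sup>2\<close>, \<open>\<parallel>v\<parallel>\<^sup>2\<close> is at most the maximum.
\<close>

lemma Buzano_pair:
  fixes P1 P2 Q1 Q2 :: "'a::chilbert_space \<Rightarrow>\<^sub>L 'a"
  assumes pos: "positive_op P1" "positive_op P2" "positive_op Q1" "positive_op Q2"
    and unit: "(norm u)\<^sup>2 + (norm v)\<^sup>2 = 1"
  shows "(Re (cinner (P1 u) u) + Re (cinner (P2 v) v)) * (Re (cinner (Q1 u) u) + Re (cinner (Q2 v) v))
    \<le> 1 / 4 * max (norm ((P1 o\<^sub>L P1) + (Q1 o\<^sub>L Q1))) (norm ((P2 o\<^sub>L P2) + (Q2 o\<^sub>L Q2)))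
      + 1 / 2 * max (numerical_radius (P1 o\<^sub>L Q1)) (numerical_radius (P2 o\<^sub>L Q2))"
proof -
  note sa = pos[THEN positive_op_selfadjoint]
  define a where "a = (P1 u, P2 v)"
  define b where "b = (Q1 u, Q2 v)"
  define X where "X = Re (cinner (P1 u) u) + Re (cinner (P2 v) v)"
  define Y where "Y = Re (cinner (Q1 u) u) + Re (cinner (Q2 v) v)"
  define N where "N = max (norm ((P1 o\<^sub>L P1) + (Q1 o\<^sub>L Q1))) (norm ((P2 o\<^sub>L P2) + (Q2 o\<^sub>L Q2)))"
  define W where "W = max (numerical_radius (P1 o\<^sub>L Q1)) (numerical_radius (P2 o\<^sub>L Q2))"
  have n1: "norm (u, v) = 1" using unit by (simp add: norm_prod_def)
  have cX: "cinner a (u, v) = complex_of_real X"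
    using selfadjoint_cinner_real[OF sa(1), of u] selfadjoint_cinner_real[OF sa(2), of v]
    by (simp add: a_def X_def cinner_prod_def)
  have cY: "cinner (u, v) b = complex_of_real Y"
    using selfadjoint_cinner_real[OF sa(3), of u] selfadjoint_cinner_real[OF sa(4), of v]
      selfadjoint_opD[OF sa(3), of u u] selfadjoint_opD[OF sa(4), of v v]
    by (simp add: b_def Y_def cinner_prod_def)
  have "0 \<le> X" "0 \<le> Y" using pos by (auto simp: X_def Y_def positive_op_nonneg intro!: add_nonneg_nonneg)
  then have "X * Y = cmod (cinner a (u, v) * cinner (u, v) b)" by (simp add: cX cY norm_mult)
  also have "\<dots> \<le> (norm a * norm b + cmod (cinner a b)) / 2"
    by (rule Buzano_inequality[OF n1])
  finally have XY: "X * Y \<le> (norm a * norm b + cmod (cinner a b)) / 2" .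
  have convex: "z * (norm u)\<^sup>2 + w * (norm v)\<^sup>2 \<le> max z w" for z w
  proof -
    have "z * (norm u)\<^sup>2 + w * (norm v)\<^sup>2 \<le> max z w * (norm u)\<^sup>2 + max z w * (norm v)\<^sup>2"
      by (intro add_mono mult_right_mono) auto
    also have "\<dots> = max z w" using unit by (simp flip: distrib_left)
    finally show ?thesis .
  qed
  have "2 * (norm a * norm b) \<le> (norm a)\<^sup>2 + (norm b)\<^sup>2"
    using zero_le_power2[of "norm a - norm b"] by (simp add: power2_diff)
  also have "\<dots> = Re (cinner (((P1 o\<^sub>L P1) + (Q1 o\<^sub>L Q1)) u) u) + Re (cinner (((P2 o\<^sub>L P2) + (Q2 o\<^sub>L Q2)) v) v)"
    by (simp add: a_def b_def norm_prod_def blinfun.add_left cinner.add_left Re_cinner_selfadjoint_twice sa)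
  also have "\<dots> \<le> norm ((P1 o\<^sub>L P1) + (Q1 o\<^sub>L Q1)) * (norm u)\<^sup>2 + norm ((P2 o\<^sub>L P2) + (Q2 o\<^sub>L Q2)) * (norm v)\<^sup>2"
    by (intro add_mono Re_cinner_le_norm)
  also have "\<dots> \<le> N" unfolding N_def by (rule convex)
  finally have ab: "2 * (norm a * norm b) \<le> N" .
  have cross: "cmod (cinner (P z) (Q z)) \<le> numerical_radius (P o\<^sub>L Q) * (norm z)\<^sup>2"
    if "selfadjoint_op P" for P Q :: "'a \<Rightarrow>\<^sub>L 'a" and z
  proof -
    have "cmod (cinner (P z) (Q z)) = cmod (cinner ((P o\<^sub>L Q) z) z)"
      using selfadjoint_opD[OF that, of "Q z" z] cinner_commute[of "P z" "Q z"] by simp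
    then show ?thesis by (metis cmod_cinner_le_numerical_radius)
  qed
  have "cmod (cinner a b) \<le> cmod (cinner (P1 u) (Q1 u)) + cmod (cinner (P2 v) (Q2 v))"
    by (simp add: a_def b_def cinner_prod_def norm_triangle_ineq)
  also have "\<dots> \<le> numerical_radius (P1 o\<^sub>L Q1) * (norm u)\<^sup>2 + numerical_radius (P2 o\<^sub>L Q2) * (norm v)\<^sup>2"
    by (intro add_mono cross sa)
  also have "\<dots> \<le> W" unfolding W_def by (rule convex)
  finally have "cmod (cinner a b) \<le> W" .
  with XY ab have "X * Y \<le> 1 / 4 * N + 1 / 2 * W" by (simp add: field_simps)
  then show ?thesis by (simp only: X_def Y_def N_def W_def)
qed

lemma offdiag_op_apply [simp]: "offdiag_op A B z = (A (snd z), B (fst z))"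
  by transfer simp

theorem theorem4p1:
  fixes A B :: "'a::chilbert_space \<Rightarrow>\<^sub>L 'a" and r \<theta> :: real
  assumes "clinear_op A" and "clinear_op B"
    and "r \<ge> 1" and "0 \<le> \<theta>" and "\<theta> \<le> 1"
  shows "numerical_radius (offdiag_op A B) powr (2 * r) \<le>
    1 / 4 * max
      (norm (op_powr (op_abs B) (4 * r * \<theta>)
           + op_powr (op_abs (cadjoint A)) (4 * r * (1 - \<theta>))))
      (norm (op_powr (op_abs A) (4 * r * \<theta>)
           + op_powr (op_abs (cadjoint B)) (4 * r * (1 - \<theta>))))
  + 1 / 2 * max
      (numerical_radius (op_powr (op_abs B) (2 * r * \<theta>)
           o\<^sub>L op_powr (op_abs (cadjoint A)) (2 * r * (1 - \<theta>))))
      (numerical_radius (op_powr (op_abs A) (2 * r * \<theta>)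
           o\<^sub>L op_powr (op_abs (cadjoint B)) (2 * r * (1 - \<theta>))))"
  (is "_ \<le> ?rhs")
proof -
  have r0: "r > 0" using \<open>r \<ge> 1\<close> by simp
  have pos: "positive_op (op_abs A)" "positive_op (op_abs B)"
    "positive_op (op_abs (cadjoint A))" "positive_op (op_abs (cadjoint B))"
    using assms(1,2) by (auto intro: positive_op_abs clinear_cadjoint)
  have exps: "0 \<le> 2 * \<theta>" "0 \<le> 2 * (1 - \<theta>)" "0 \<le> 2 * r * \<theta>" "0 \<le> 2 * r * (1 - \<theta>)"
    using assms(3-5) by auto
  have bound: "cmod (cinner (offdiag_op A B z) z) powr (2 * r) \<le> ?rhs" if "norm z = 1" for z
  proof -
    obtain u v where z: "z = (u, v)" by (cases z)
    have unit: "(norm u)\<^sup>2 + (norm v)\<^sup>2 = 1" using that by (simp add: z norm_prod_def)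
    define form where "form S a x = Re (cinner (op_powr S a x) x)" for S :: "'a \<Rightarrow>\<^sub>L 'a" and a x
    have form_nonneg: "0 \<le> form S a x" if "positive_op S" "0 \<le> a" for S a x
      unfolding form_def using that by (intro positive_op_nonneg op_powr_positive)
    define X where "X = form (op_abs B) (2 * \<theta>) u + form (op_abs A) (2 * \<theta>) v"
    define Y where "Y = form (op_abs (cadjoint A)) (2 * (1 - \<theta>)) u
      + form (op_abs (cadjoint B)) (2 * (1 - \<theta>)) v"
    have XY: "0 \<le> X" "0 \<le> Y" unfolding X_def Y_def by (intro add_nonneg_nonneg form_nonneg pos exps)+
    have "cmod (cinner (offdiag_op A B z) z) \<le> cmod (cinner (B u) v) + cmod (cinner (A v) u)"
      by (simp add: z cinner_prod_def) (metis add.commute norm_triangle_ineq)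
    then have "(cmod (cinner (offdiag_op A B z) z))\<^sup>2 \<le> (cmod (cinner (B u) v) + cmod (cinner (A v) u))\<^sup>2"
      by (intro power_mono) auto
    also have "\<dots> \<le> X * (form (op_abs (cadjoint B)) (2 * (1 - \<theta>)) v
        + form (op_abs (cadjoint A)) (2 * (1 - \<theta>)) u)"
      unfolding X_def
      by (intro Cauchy_Schwarz_two_terms form_nonneg pos exps)
        (use assms in \<open>auto simp only: form_def intro!: mixed_Schwarz\<close>)
    finally have sq: "(cmod (cinner (offdiag_op A B z) z))\<^sup>2 \<le> X * Y" by (simp add: Y_def add.commute)
    have "cmod (cinner (offdiag_op A B z) z) powr (2 * r) = ((cmod (cinner (offdiag_op A B z) z))\<^sup>2) powr r"
      by (simp add: powr_powr flip: powr_numeral)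
    also have "\<dots> \<le> (X * Y) powr r" using sq r0 by (intro powr_mono2) auto
    also have "\<dots> = X powr r * Y powr r" using XY by (simp add: powr_mult)
    also have "\<dots> \<le> (form (op_abs B) (r * (2 * \<theta>)) u + form (op_abs A) (r * (2 * \<theta>)) v)
        * (form (op_abs (cadjoint A)) (r * (2 * (1 - \<theta>))) u
          + form (op_abs (cadjoint B)) (r * (2 * (1 - \<theta>))) v)"
      unfolding X_def Y_def form_def
      by (intro mult_mono McCarthy_inequality_pair pos exps assms unit add_nonneg_nonneg
          positive_op_nonneg op_powr_positive mult_nonneg_nonneg[of r] less_imp_le[OF r0]) auto
    also have "\<dots> \<le> ?rhs"
    proof -
      have sq: "op_powr S (2 * r * t) o\<^sub>L op_powr S (2 * r * t) = op_powr S (4 * r * t)"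
        if "positive_op S" "0 \<le> 2 * r * t" for S :: "'a \<Rightarrow>\<^sub>L 'a" and t
        using op_powr_twice[OF that] by (simp add: mult.assoc)
      have comm: "r * (2 * t) = 2 * r * t" for t by simp
      show ?thesis
        using Buzano_pair[OF op_powr_positive[OF pos(2) exps(3)] op_powr_positive[OF pos(1) exps(3)]
            op_powr_positive[OF pos(3) exps(4)] op_powr_positive[OF pos(4) exps(4)] unit]
        unfolding form_def comm by (simp only: sq pos exps)
    qed
    finally show ?thesis .
  qed
  have rhs: "0 \<le> ?rhs" by (intro add_nonneg_nonneg mult_nonneg_nonneg) (auto simp: le_max_iff_disj numerical_radius_nonneg)
  have "numerical_radius (offdiag_op A B) \<le> ?rhs powr (1 / (2 * r))"
    unfolding numerical_radius_def[of "offdiag_op A B"]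
  proof (rule cSup_least)
    fix c assume "c \<in> insert 0 {cmod (cinner (offdiag_op A B z) z) | z. norm z = 1}"
    then consider "c = 0" | z where "norm z = 1" "c = cmod (cinner (offdiag_op A B z) z)" by blast
    then show "c \<le> ?rhs powr (1 / (2 * r))"
    proof cases
      case 2
      have "c = (c powr (2 * r)) powr (1 / (2 * r))" using r0 2 by (simp add: powr_powr)
      also have "\<dots> \<le> ?rhs powr (1 / (2 * r))"
        using bound[OF 2(1)] r0 unfolding 2(2) by (intro powr_mono2) auto
      finally show ?thesis .
    qed simp
  qed simp
  then have "numerical_radius (offdiag_op A B) powr (2 * r) \<le> (?rhs powr (1 / (2 * r))) powr (2 * r)"
    using r0 by (intro powr_mono2 numerical_radius_nonneg) auto
  also have "\<dots> = ?rhs" unfolding powr_powr using r0 rhs by simp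
  finally show ?thesis .
qed

end
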